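(* Fix $d\ge 1$ and let $\tilde X$ be a $d\times p$ matrix at which prediction is desired. Let $\beta^\star$ be the true coefficient vector, with configuration $S^\star=S_{\beta^\star}$, and let $f^n_{\tilde X}$ be the empirical Bayes predictive distribution (see the context for definitions). If $\mathsf{E}_{\beta^\star}\pi^n(S^\star)\to1$ as $n\to\infty$, then $$\mathsf{E}_{\beta^\star}\, d_{\mathrm{TV}}\bigl(f^n_{\tilde X},\ \mathsf{N}_d(\hat\psi_{S^\star},\sigma^2(I_d+V_{S^\star}))\bigr)\to0,$$ where $d_{\mathrm{TV}}(P,Q)=\sup_A|P(A)-Q(A)|$ is the total variation distance.
   Context: Model: $y = X\beta + \sigma z$, with $y \in \mathbb{R}^n$, $X$ a (non-random) $n \times p$ matrix, $z$ a vector of $n$ independent standard normals, and $\sigma^2 > 0$ known. Asymptotics are as $n\to\infty$, with $p = p_n \ge n$, $X = X_n$, $\tilde X=\tilde X_n$ and $\beta^\star=\beta^\star_n$ depending on $n$; the rank $R$ of $X$ equals $n$. Standing assumption: with $s^\star=|S_{\beta^\star}|$, $s^\star\log(p/s^\star)=o(n)$. $\mathsf{E}_{\beta^\star}$ is expectation over $y \sim \mathsf{N}_n(X\beta^\star, \sigma^2 I)$. For $\beta\in\mathbb{R}^p$, $S_\beta = \{j : \beta_j \neq 0\}$, and $|S|$ is the cardinality of $S$. Empirical prior: for $S \subseteq \{1,\dots,p\}$ with $|S| \le R$, $\pi(S) = \binom{p}{|S|}^{-1} q_n(|S|)$, where $q_n$ is the probability mass function on $\{0,1,\dots,R\}$ with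 $q_n(s) \propto (c p^a)^{-s}$, and $a, c > 0$ are fixed constants. Let $X_S$, $\tilde X_S$ be the submatrices of $X$, $\tilde X$ with columns indexed by $S$ ($X_S^\top X_S$ is taken to be invertible for the $S$ supported by the prior) and $\hat\beta_S = (X_S^\top X_S)^{-1} X_S^\top y$ the least squares estimator. Fix constants $\gamma > 0$ and $\alpha \in (0,1)$. The prior is $$\Pi_n(d\beta) = \sum_S \pi(S)\, \mathsf{N}_{|S|}\bigl(d\beta_S \mid \hat\beta_S, \sigma^2\gamma^{-1}(X_S^\top X_S)^{-1}\bigr) \otimes \delta_{0_{S^c}}(d\beta_{S^c}),$$ where $\delta_{0_{S^c}}$ is the point mass at the origin for the coordinates in $S^c$. Empirical Bayes posterior: $\Pi^n(d\beta) \propto L_n(\beta)^\alpha\, \Pi_n(d\beta)$, with $L_n(\beta) = \mathsf{N}_n(y \mid X\beta, \sigma^2 I) \propto \exp\{-\|y - X\beta\|^2/(2\sigma^2)\}$. The marginal posterior of $S$ is $$\pi^n(S) \propto \pi(S)\bigl(\tfrac{\gamma}{\alpha+\gamma}\bigr)^{|S|/2}\exp\{-\tfrac{\alpha}{2\sigma^2}\|y - X_S\hat\beta_S\|^2\}.$$ Put $\hat\psi_S=\tilde X_S\hat\beta_S$ and $V_S=(\alpha+\gamma)^{-1}\tilde X_S(X_S^\top X_S)^{-1}\tilde X_S^\top$. The empirical Bayes predictive distribution of a new response at $\tilde X$ has density $$f^n_{\tilde X}(\tilde y)=\int\mathsf{N}_d(\tilde y\mid\tilde X\beta,\sigma^2I_d)\,\Pi^n(d\beta)=\sum_S\pi^n(S)\,\mathsf{N}_d\bigl(\tilde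 y\mid\hat\psi_S,\ \sigma^2(I_d+V_S)\bigr);$$ the same symbol denotes the distribution and its density. *)

theory Defs
  imports
    "HOL-Probability.Probability"
    "HOL-Library.Landau_Symbols"
    "Jordan_Normal_Form.Gauss_Jordan_Elimination"
    "Jordan_Normal_Form.Determinant"
    "Jordan_Normal_Form.DL_Rank"
    "Jordan_Normal_Form.DL_Submatrix"
begin

(* Vectors and matrices are those of Jordan_Normal_Form, because n and p vary along the asymptotic
   sequence.  Indices are 0-based: {1..p} is rendered as {..<p}.  HOL-Analysis declares clashing
   notation for vec, det, component access and inner product, hence the qualified and prefix
   forms below. *)

(* Meaningful for invertible A only. *)
definition mat_inv :: "real mat \<Rightarrow> real mat" where
  "mat_inv A = the (mat_inverse A)"

(* Lebesgue measure on R^n, carried by carrier_vec n. *)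
definition lborel_vec :: "nat \<Rightarrow> real Matrix.vec measure" where
  "lborel_vec n = embed_measure (\<Pi>\<^sub>M i\<in>{..<n}. (lborel :: real measure)) (Matrix.vec n)"

definition mvn_density :: "real Matrix.vec \<Rightarrow> real mat \<Rightarrow> real Matrix.vec \<Rightarrow> real" where
  "mvn_density m \<Sigma> x =
     exp (- scalar_prod (x - m) (mat_inv \<Sigma> *\<^sub>v (x - m)) / 2)
       / sqrt ((2 * pi) ^ dim_vec m * Determinant.det \<Sigma>)"

definition mvn :: "real Matrix.vec \<Rightarrow> real mat \<Rightarrow> real Matrix.vec measure" where
  "mvn m \<Sigma> = density (lborel_vec (dim_vec m)) (\<lambda>x. ennreal (mvn_density m \<Sigma> x))"

(* Intended for probability measures P, Q with the same measurable sets. *)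
definition tv_dist :: "'a measure \<Rightarrow> 'a measure \<Rightarrow> real" where
  "tv_dist P Q = (SUP A\<in>sets P. \<bar>measure P A - measure Q A\<bar>)"

definition vec_support :: "real Matrix.vec \<Rightarrow> nat set" where
  "vec_support \<beta> = {j. j < dim_vec \<beta> \<and> vec_index \<beta> j \<noteq> 0}"

definition mat_rank :: "real mat \<Rightarrow> nat" where
  "mat_rank X = vec_space.rank (dim_row X) X"

definition sub_cols :: "real mat \<Rightarrow> nat set \<Rightarrow> real mat" where
  "sub_cols X S = submatrix X UNIV S"

definition gram :: "real mat \<Rightarrow> nat set \<Rightarrow> real mat" where
  "gram X S = transpose_mat (sub_cols X S) * sub_cols X S"

definition lse :: "real mat \<Rightarrow> real Matrix.vec \<Rightarrow> nat set \<Rightarrow> real Matrix.vec" where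
  "lse X y S = mat_inv (gram X S) *\<^sub>v (transpose_mat (sub_cols X S) *\<^sub>v y)"

(* The vector of R^p whose S-coordinates, in increasing order, are the entries of b, and whose
   other coordinates vanish. *)
definition embed_config :: "nat \<Rightarrow> nat set \<Rightarrow> real Matrix.vec \<Rightarrow> real Matrix.vec" where
  "embed_config p S b =
     Matrix.vec p (\<lambda>j. if j \<in> S then vec_index b (card {i\<in>S. i < j}) else 0)"

definition configs :: "real mat \<Rightarrow> nat set set" where
  "configs X = {S. S \<subseteq> {..<dim_col X} \<and> card S \<le> mat_rank X}"

definition size_prior :: "real \<Rightarrow> real \<Rightarrow> real mat \<Rightarrow> nat \<Rightarrow> real" where
  "size_prior a c X s =
     1 / (c * real (dim_col X) powr a) ^ s
       / (\<Sum>t\<le>mat_rank X. 1 / (c * real (dim_col X) powr a) ^ t)"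

definition config_prior :: "real \<Rightarrow> real \<Rightarrow> real mat \<Rightarrow> nat set \<Rightarrow> real" where
  "config_prior a c X S =
     (if S \<in> configs X then size_prior a c X (card S) / real (dim_col X choose card S) else 0)"

(* N_{|S|}(hat beta_S, sigma^2 gamma^{-1} (X_S^T X_S)^{-1}) on the coordinates in S, times the
   point mass at 0 on the remaining ones. *)
definition slab :: "real \<Rightarrow> real \<Rightarrow> real mat \<Rightarrow> real Matrix.vec \<Rightarrow> nat set \<Rightarrow> real Matrix.vec measure" where
  "slab \<gamma> \<sigma> X y S =
     distr (mvn (lse X y S) ((\<sigma>\<^sup>2 / \<gamma>) \<cdot>\<^sub>m mat_inv (gram X S)))
       (lborel_vec (dim_col X)) (embed_config (dim_col X) S)"

definition emp_prior ::
    "real \<Rightarrow> real \<Rightarrow> real \<Rightarrow> real \<Rightarrow> real mat \<Rightarrow> real Matrix.vec \<Rightarrow> real Matrix.vec measure" where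
  "emp_prior a c \<gamma> \<sigma> X y =
     measure_of (space (lborel_vec (dim_col X))) (sets (lborel_vec (dim_col X)))
       (\<lambda>A. \<Sum>S\<in>configs X. ennreal (config_prior a c X S) * emeasure (slab \<gamma> \<sigma> X y S) A)"

definition likelihood ::
    "real \<Rightarrow> real mat \<Rightarrow> real Matrix.vec \<Rightarrow> real Matrix.vec \<Rightarrow> real" where
  "likelihood \<sigma> X y \<beta> = mvn_density (X *\<^sub>v \<beta>) (\<sigma>\<^sup>2 \<cdot>\<^sub>m 1\<^sub>m (dim_row X)) y"

definition emp_posterior ::
    "real \<Rightarrow> real \<Rightarrow> real \<Rightarrow> real \<Rightarrow> real \<Rightarrow> real mat \<Rightarrow> real Matrix.vec \<Rightarrow> real Matrix.vec measure" where
  "emp_posterior a c \<gamma> \<alpha> \<sigma> X y =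
     density (emp_prior a c \<gamma> \<sigma> X y)
       (\<lambda>\<beta>. ennreal (likelihood \<sigma> X y \<beta> powr \<alpha>
              / (\<integral>\<beta>'. likelihood \<sigma> X y \<beta>' powr \<alpha> \<partial>emp_prior a c \<gamma> \<sigma> X y)))"

definition config_weight ::
    "real \<Rightarrow> real \<Rightarrow> real \<Rightarrow> real \<Rightarrow> real \<Rightarrow> real mat \<Rightarrow> real Matrix.vec \<Rightarrow> nat set \<Rightarrow> real" where
  "config_weight a c \<gamma> \<alpha> \<sigma> X y S =
     (let r = y - sub_cols X S *\<^sub>v lse X y S
      in config_prior a c X S * (\<gamma> / (\<alpha> + \<gamma>)) powr (real (card S) / 2)
           * exp (- \<alpha> / (2 * \<sigma>\<^sup>2) * scalar_prod r r))"

definition config_posterior ::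
    "real \<Rightarrow> real \<Rightarrow> real \<Rightarrow> real \<Rightarrow> real \<Rightarrow> real mat \<Rightarrow> real Matrix.vec \<Rightarrow> nat set \<Rightarrow> real" where
  "config_posterior a c \<gamma> \<alpha> \<sigma> X y S =
     config_weight a c \<gamma> \<alpha> \<sigma> X y S / (\<Sum>T\<in>configs X. config_weight a c \<gamma> \<alpha> \<sigma> X y T)"

definition pred_mean :: "real mat \<Rightarrow> real mat \<Rightarrow> real Matrix.vec \<Rightarrow> nat set \<Rightarrow> real Matrix.vec" where
  "pred_mean X Xt y S = sub_cols Xt S *\<^sub>v lse X y S"

definition pred_V :: "real \<Rightarrow> real \<Rightarrow> real mat \<Rightarrow> real mat \<Rightarrow> nat set \<Rightarrow> real mat" where
  "pred_V \<gamma> \<alpha> X Xt S =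
     (1 / (\<alpha> + \<gamma>)) \<cdot>\<^sub>m (sub_cols Xt S * mat_inv (gram X S) * transpose_mat (sub_cols Xt S))"

(* The predictive density is the integral against the posterior; its closed form as a mixture of
   normals is a theorem, not part of the definition. *)
definition pred_density ::
    "real \<Rightarrow> real \<Rightarrow> real \<Rightarrow> real \<Rightarrow> real \<Rightarrow> real mat \<Rightarrow> real mat \<Rightarrow> real Matrix.vec \<Rightarrow> real Matrix.vec \<Rightarrow> real" where
  "pred_density a c \<gamma> \<alpha> \<sigma> X Xt y yt =
     (\<integral>\<beta>. mvn_density (Xt *\<^sub>v \<beta>) (\<sigma>\<^sup>2 \<cdot>\<^sub>m 1\<^sub>m (dim_row Xt)) yt
        \<partial>emp_posterior a c \<gamma> \<alpha> \<sigma> X y)"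

definition pred_dist ::
    "real \<Rightarrow> real \<Rightarrow> real \<Rightarrow> real \<Rightarrow> real \<Rightarrow> real mat \<Rightarrow> real mat \<Rightarrow> real Matrix.vec \<Rightarrow> real Matrix.vec measure" where
  "pred_dist a c \<gamma> \<alpha> \<sigma> X Xt y =
     density (lborel_vec (dim_row Xt)) (\<lambda>yt. ennreal (pred_density a c \<gamma> \<alpha> \<sigma> X Xt y yt))"

end

(* The predictive density is the mixture, with weights pi^n(S), of the normal densities
   N_d(psi_S, sigma^2 (I + V_S)), so its total variation distance to the component at the true
   configuration is at most the posterior mass of the other configurations; taking expectations
   gives the claim.

   For the mixture form, the tempered likelihood factors through the residual of the least squares
   fit (Pythagoras), which turns each slab into a normal with precision
   ((alpha + gamma) / sigma^2) X_S^T X_S, and completing the square in the coefficients integrates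
   them out.  Normals are handled through their precision matrices; a Gaussian integral is computed
   by induction on the dimension, splitting off one coordinate with the Schur complement. *)

theory Submission
  imports Defs
begin

section \<open>Gaussian integrals\<close>

text \<open>The empirical prior is what makes the posterior explicit. On a configuration both the
  slab and the likelihood are quadratic in the coefficients around the same point, the least squares
  estimator, so tempering adds \<open>\<alpha>\<close> to \<open>\<gamma>\<close> in the precision
  and does not move the centre. What is left over depends on the configuration only through its size
  and its residual, and is the factor in \<open>config_weight\<close>. Precisions are the natural
  coordinates for this, because they add when densities are multiplied. The predictive normals,
  however, are given by covariances that arise from integrating coefficients out. The link is a
  Woodbury identity together with the matching determinant identity, both obtained from one
  quadratic minimization problem. All integrands are nonnegative, so the computations run in the
  extended nonnegative reals and need no integrability; the Bochner integrals of the definitions are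
  converted only where the value is known to be finite. In the limit, positivity of the expected
  posterior mass of the true configuration, valid for large \<open>n\<close>, does double duty: it
  places that configuration in the support of the prior and makes its posterior mass
  integrable.\<close>

abbreviation quad_form :: "real mat \<Rightarrow> real Matrix.vec \<Rightarrow> real" where
  "quad_form Q x \<equiv> scalar_prod x (Q *\<^sub>v x)"

definition pos_def :: "nat \<Rightarrow> real mat \<Rightarrow> bool" where
  "pos_def k Q \<longleftrightarrow> Q \<in> carrier_mat k k \<and> transpose_mat Q = Q \<and>
     (\<forall>x\<in>carrier_vec k. x \<noteq> 0\<^sub>v k \<longrightarrow> 0 < quad_form Q x)"

lemma nn_integral_gauss_1dim:
  fixes q t :: real
  assumes "q > 0"
  shows "(\<integral>\<^sup>+x. ennreal (exp (- (q * (x - t)\<^sup>2) / 2)) \<partial>lborel) = ennreal (sqrt (2 * pi / q))"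
proof -
  define s where "s = 1 / sqrt q"
  have s: "s > 0" "s\<^sup>2 = 1 / q" using assms by (auto simp: s_def power_divide)
  interpret prob_space "density lborel (normal_density t s)"
    by (rule prob_space_normal_density[OF s(1)])
  have one: "(\<integral>\<^sup>+x. ennreal (normal_density t s x) \<partial>lborel) = 1"
    using emeasure_space_1 by (simp add: emeasure_density)
  have "exp (- (q * (x - t)\<^sup>2) / 2) = sqrt (2 * pi / q) * normal_density t s x" for x
    using assms by (simp add: normal_density_def s field_simps)
  then have "(\<integral>\<^sup>+x. ennreal (exp (- (q * (x - t)\<^sup>2) / 2)) \<partial>lborel)
      = (\<integral>\<^sup>+x. ennreal (sqrt (2 * pi / q)) * ennreal (normal_density t s x) \<partial>lborel)"
    using assms by (simp add: ennreal_mult')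
  also have "\<dots> = ennreal (sqrt (2 * pi / q))"
    by (subst nn_integral_cmult) (auto simp: one)
  finally show ?thesis .
qed

text \<open>Subtracting multiples of the last row from the others clears the last column above the
  pivot. \<open>L\<close> records this elimination and has determinant 1, being block triangular
  with identity blocks on the diagonal.\<close>

lemma det_schur_complement:
  fixes q :: "nat \<Rightarrow> nat \<Rightarrow> real"
  assumes "q k k \<noteq> 0"
  shows "Determinant.det (Matrix.mat (Suc k) (Suc k) (\<lambda>(i,j). q i j))
    = q k k * Determinant.det (Matrix.mat k k (\<lambda>(i,j). q i j - q i k * q k j / q k k))"
proof -
  define L where "L = four_block_mat (1\<^sub>m k) (Matrix.mat k 1 (\<lambda>(i,_). - q i k / q k k)) (0\<^sub>m 1 k) (1\<^sub>m 1)"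
  define B where "B = Matrix.mat k k (\<lambda>(i,j). q i j - q i k * q k j / q k k)"
  define C where "C = Matrix.mat 1 k (\<lambda>(_,j). q k j)"
  define D where "D = Matrix.mat 1 1 (\<lambda>(_,_). q k k)"
  define M where "M = Matrix.mat (Suc k) (Suc k) (\<lambda>(i,j). q i j)"
  have M: "M = four_block_mat (Matrix.mat k k (\<lambda>(i,j). q i j)) (Matrix.mat k 1 (\<lambda>(i,_). q i k)) C D"
    unfolding M_def C_def D_def
    by (rule eq_matI) (auto simp: less_Suc_eq)
  have LM: "L * M = four_block_mat B (0\<^sub>m k 1) C D"
    unfolding L_def M
    apply (subst mult_four_block_mat[of _ k k _ 1 _ 1])
    apply (auto simp: C_def D_def)
    apply (rule cong_four_block_mat)
    using assms by (auto simp: B_def scalar_prod_def)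
  have "Determinant.det L * Determinant.det M = Determinant.det (L * M)"
    by (rule det_mult[symmetric, of _ "Suc k"]) (auto simp: L_def M_def)
  moreover have "Determinant.det L = 1"
    unfolding L_def by (subst det_four_block_mat_lower_left_zero[of _ k _ 1]) auto
  moreover have "Determinant.det (L * M) = Determinant.det B * Determinant.det D"
    unfolding LM by (rule det_four_block_mat_upper_right_zero) (auto simp: B_def C_def D_def)
  moreover have "Determinant.det D = q k k"
    by (simp add: D_def det_single)
  ultimately show ?thesis by (simp add: M_def B_def)
qed

text \<open>By symmetry the cross terms with the last variable occur twice. Absorbing them into a
  square costs \<open>b\<^sup>2 / q k k\<close>, which is exactly the rank one correction that forms
  the Schur complement of \<open>det_schur_complement\<close>.\<close>

lemma quad_sum_complete_square:
  fixes q :: "nat \<Rightarrow> nat \<Rightarrow> real"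
  assumes sym: "\<And>i j. q i j = q j i" and "q k k \<noteq> 0"
  shows "(\<Sum>i<Suc k. \<Sum>j<Suc k. q i j * x i * x j)
    = q k k * (x k + (\<Sum>j<k. q k j * x j) / q k k)\<^sup>2
      + (\<Sum>i<k. \<Sum>j<k. (q i j - q i k * q k j / q k k) * x i * x j)"
proof -
  define b where "b = (\<Sum>j<k. q k j * x j)"
  have c: "(\<Sum>i<k. q i k * x i) = b"
    unfolding b_def by (rule sum.cong) (simp_all only: sym[of _ k])
  have "(\<Sum>i<Suc k. \<Sum>j<Suc k. q i j * x i * x j)
      = (\<Sum>i<k. \<Sum>j<k. q i j * x i * x j) + x k * (\<Sum>i<k. q i k * x i) + x k * b + q k k * (x k)\<^sup>2"
    by (simp add: b_def sum.distrib sum_distrib_left power2_eq_square algebra_simps)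
  moreover have "(\<Sum>i<k. \<Sum>j<k. (q i j - q i k * q k j / q k k) * x i * x j)
      = (\<Sum>i<k. \<Sum>j<k. q i j * x i * x j) - (\<Sum>i<k. q i k * x i) * b / q k k"
    unfolding b_def sum_product sum_divide_distrib
    by (simp add: sum_subtractf algebra_simps)
  moreover have "F + x k * b + x k * b + q k k * (x k)\<^sup>2 = q k k * (x k + b / q k k)\<^sup>2 + (F - b * b / q k k)" for F
    using assms(2) by (simp add: field_simps power2_eq_square)
  ultimately show ?thesis
    unfolding c b_def[symmetric] by (simp only:)
qed

lemma measurable_quad_sum_PiM:
  "(\<lambda>x. \<Sum>i<k. \<Sum>j<k. q i j * (x i - m i) * (x j - m j :: real))
     \<in> borel_measurable (\<Pi>\<^sub>M i\<in>{..<k}. (lborel :: real measure))"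
  by (intro borel_measurable_sum borel_measurable_times borel_measurable_diff
        borel_measurable_const measurable_component_singleton[where M="\<lambda>_. lborel :: real measure", simplified])
     auto

text \<open>The coefficients are a function on all index pairs instead of a matrix, so the induction
  passes to the Schur complement without any change of carrier. Positivity of the determinant is
  carried along: it lets the square roots multiply as extended reals, and later it yields
  invertibility.\<close>

lemma nn_integral_gauss_PiM:
  fixes q :: "nat \<Rightarrow> nat \<Rightarrow> real" and m :: "nat \<Rightarrow> real"
  assumes sym: "\<And>i j. q i j = q j i"
    and pos: "\<And>x. \<exists>i<k. x i \<noteq> 0 \<Longrightarrow> 0 < (\<Sum>i<k. \<Sum>j<k. q i j * x i * x j)"
  shows "0 < Determinant.det (Matrix.mat k k (\<lambda>(i,j). q i j)) \<and>
    (\<integral>\<^sup>+x. ennreal (exp (- (\<Sum>i<k. \<Sum>j<k. q i j * (x i - m i) * (x j - m j)) / 2))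
       \<partial>(\<Pi>\<^sub>M i\<in>{..<k}. (lborel :: real measure)))
    = ennreal (sqrt ((2 * pi) ^ k / Determinant.det (Matrix.mat k k (\<lambda>(i,j). q i j))))"
  using sym pos
proof (induction k arbitrary: q)
  case 0
  interpret product_sigma_finite "\<lambda>_::nat. lborel :: real measure" by standard
  show ?case
    using det_dim_zero[of "Matrix.mat 0 0 (\<lambda>(i,j). q i j)"] by (simp add: PiM_empty)
next
  case (Suc k)
  interpret product_sigma_finite "\<lambda>_::nat. lborel :: real measure" by standard
  define q' where "q' i j = q i j - q i k * q k j / q k k" for i j
  let ?d = "Determinant.det (Matrix.mat k k (\<lambda>(i,j). q' i j))"
  \<comment> \<open>The pivot is the value of the form at the last unit vector.\<close>
  have qk: "0 < q k k"
    using Suc.prems(2)[of "\<lambda>i. if i = k then 1 else 0"] by (simp add: if_distrib cong: if_cong)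
  note square = quad_sum_complete_square[of q k, OF Suc.prems(1), folded q'_def]
  have pos': "0 < (\<Sum>i<k. \<Sum>j<k. q' i j * x i * x j)" if "\<exists>i<k. x i \<noteq> 0" for x
  proof -
    \<comment> \<open>This last coordinate minimizes the form for the given other ones: it makes the
      square vanish, so that the full form at \<open>z\<close> is the Schur complement form at
      \<open>x\<close>.\<close>
    define z where "z = x(k := - (\<Sum>j<k. q k j * x j) / q k k)"
    have "0 < (\<Sum>i<Suc k. \<Sum>j<Suc k. q i j * z i * z j)"
      using that by (intro Suc.prems(2)) (auto simp: z_def less_Suc_eq)
    also have "\<dots> = (\<Sum>i<k. \<Sum>j<k. q' i j * x i * x j)"
      using qk by (subst square) (auto simp: z_def)
    finally show ?thesis .
  qed
  have sym': "q' i j = q' j i" for i j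
    unfolding q'_def by (metis Suc.prems(1) mult.commute)
  note IH1 = Suc.IH[of q', OF sym' pos', THEN conjunct1]
  note IH2 = Suc.IH[of q', OF sym' pos', THEN conjunct2]
  have det: "Determinant.det (Matrix.mat (Suc k) (Suc k) (\<lambda>(i,j). q i j)) = q k k * ?d"
    using det_schur_complement[of q k] qk by (simp add: q'_def)
  have sqrt: "sqrt ((2 * pi) ^ k / ?d) * sqrt (2 * pi / q k k) = sqrt ((2 * pi) ^ Suc k / (q k k * ?d))"
    by (subst real_sqrt_mult[symmetric]) (simp add: mult.commute)
  have borel_measurable_exp_quad: "(\<lambda>x. ennreal (exp (- (\<Sum>i<n. \<Sum>j<n. r i j * (x i - m i) * (x j - m j)) / 2)))
      \<in> borel_measurable (\<Pi>\<^sub>M i\<in>{..<n}. (lborel :: real measure))" for n and r :: "nat \<Rightarrow> nat \<Rightarrow> real"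
    using measurable_quad_sum_PiM[where k = n and q = r and m = m] by measurable
  have lessThan_k: "k \<notin> {..<k}" by simp
  let ?F = "\<lambda>x. ennreal (exp (- (\<Sum>i<k. \<Sum>j<k. q' i j * (x i - m i) * (x j - m j)) / 2))"
  have "(\<integral>\<^sup>+x. ennreal (exp (- (\<Sum>i<Suc k. \<Sum>j<Suc k. q i j * (x i - m i) * (x j - m j)) / 2))
       \<partial>(\<Pi>\<^sub>M i\<in>{..<Suc k}. (lborel :: real measure)))
     = (\<integral>\<^sup>+x. (\<integral>\<^sup>+y. ennreal (exp (- (\<Sum>i<Suc k. \<Sum>j<Suc k. q i j * ((x(k:=y)) i - m i) * ((x(k:=y)) j - m j)) / 2))
         \<partial>lborel) \<partial>(\<Pi>\<^sub>M i\<in>{..<k}. (lborel :: real measure)))"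
    using product_nn_integral_insert[OF finite_lessThan[of k] lessThan_k, unfolded lessThan_Suc[symmetric],
        OF borel_measurable_exp_quad[of q]] .
  also have "\<dots> = (\<integral>\<^sup>+x. ?F x * ennreal (sqrt (2 * pi / q k k)) \<partial>(\<Pi>\<^sub>M i\<in>{..<k}. (lborel :: real measure)))"
  proof (rule nn_integral_cong)
    fix x :: "nat \<Rightarrow> real"
    \<comment> \<open>\<open>t\<close> is the conditional mean of the last coordinate given the
      others, so the inner integral is a one-dimensional Gaussian whose value does not depend on
      \<open>x\<close>.\<close>
    define t where "t = m k - (\<Sum>j<k. q k j * (x j - m j)) / q k k"
    have "exp (- (\<Sum>i<Suc k. \<Sum>j<Suc k. q i j * ((x(k:=y)) i - m i) * ((x(k:=y)) j - m j)) / 2)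
      = exp (- (\<Sum>i<k. \<Sum>j<k. q' i j * (x i - m i) * (x j - m j)) / 2) * exp (- (q k k * (y - t)\<^sup>2) / 2)" for y
      using square[of "\<lambda>i. (x(k:=y)) i - m i"] qk
      by (simp add: t_def algebra_simps diff_divide_distrib add_divide_distrib flip: exp_add del: sum.lessThan_Suc)
    then have "(\<integral>\<^sup>+y. ennreal (exp (- (\<Sum>i<Suc k. \<Sum>j<Suc k. q i j * ((x(k:=y)) i - m i) * ((x(k:=y)) j - m j)) / 2)) \<partial>lborel)
      = (\<integral>\<^sup>+y. ?F x * ennreal (exp (- (q k k * (y - t)\<^sup>2) / 2)) \<partial>lborel)"
      by (simp add: ennreal_mult' del: sum.lessThan_Suc)
    also have "\<dots> = ?F x * ennreal (sqrt (2 * pi / q k k))"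
      by (subst nn_integral_cmult) (simp, simp only: nn_integral_gauss_1dim[OF qk])
    finally show "(\<integral>\<^sup>+y. ennreal (exp (- (\<Sum>i<Suc k. \<Sum>j<Suc k. q i j * ((x(k:=y)) i - m i) * ((x(k:=y)) j - m j)) / 2)) \<partial>lborel)
      = ?F x * ennreal (sqrt (2 * pi / q k k))" .
  qed
  also have "\<dots> = ennreal (sqrt ((2 * pi) ^ k / ?d)) * ennreal (sqrt (2 * pi / q k k))"
    by (subst nn_integral_multc[OF borel_measurable_exp_quad]) (simp only: IH2)
  also have "\<dots> = ennreal (sqrt ((2 * pi) ^ Suc k / (q k k * ?d)))"
    unfolding sqrt[symmetric] by (rule ennreal_mult'[symmetric]) (use IH1 in simp)
  finally have "(\<integral>\<^sup>+x. ennreal (exp (- (\<Sum>i<Suc k. \<Sum>j<Suc k. q i j * (x i - m i) * (x j - m j)) / 2))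
       \<partial>(\<Pi>\<^sub>M i\<in>{..<Suc k}. (lborel :: real measure)))
     = ennreal (sqrt ((2 * pi) ^ Suc k / (q k k * ?d)))" .
  moreover have "0 < q k k * ?d"
    using qk IH1 by (rule mult_pos_pos)
  ultimately show ?case
    unfolding det by (rule conjI[rotated])
qed

section \<open>Lebesgue measure and normal densities on carrier vectors\<close>

text \<open>The product space contains only extensional functions, which are determined by their
  values below \<open>n\<close>. Injectivity is what allows integrals to be transported through
  \<open>embed_measure\<close>.\<close>

lemma inj_on_vec_PiM: "inj_on (Matrix.vec n) (space (\<Pi>\<^sub>M i\<in>{..<n}. (lborel :: real measure)))"
proof (rule inj_onI)
  fix f g :: "nat \<Rightarrow> real"
  assume f: "f \<in> space (\<Pi>\<^sub>M i\<in>{..<n}. (lborel :: real measure))"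
    and g: "g \<in> space (\<Pi>\<^sub>M i\<in>{..<n}. (lborel :: real measure))"
    and eq: "Matrix.vec n f = Matrix.vec n g"
  show "f = g"
  proof (rule extensionalityI[of _ "{..<n}"])
    show "f \<in> extensional {..<n}" "g \<in> extensional {..<n}"
      using f g by (auto simp: space_PiM PiE_def)
    fix i assume "i \<in> {..<n}"
    then show "f i = g i" using arg_cong[OF eq, of "\<lambda>v. vec_index v i"] by simp
  qed
qed

lemma space_lborel_vec [simp]: "space (lborel_vec n) = carrier_vec n"
proof
  show "space (lborel_vec n) \<subseteq> carrier_vec n"
    by (auto simp: lborel_vec_def space_embed_measure)
  show "carrier_vec n \<subseteq> space (lborel_vec n)"
  proof
    fix x :: "real Matrix.vec" assume x: "x \<in> carrier_vec n"
    have "x = Matrix.vec n (restrict (vec_index x) {..<n})"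
      using x by (intro eq_vecI) auto
    then show "x \<in> space (lborel_vec n)"
      unfolding lborel_vec_def space_embed_measure
      by (rule image_eqI[where f = "Matrix.vec n"]) (auto simp: space_PiM)
  qed
qed

lemma carrier_vec_in_sets_lborel_vec [simp]: "carrier_vec n \<in> sets (lborel_vec n)"
  using sets.top[of "lborel_vec n"] by simp

lemma measurable_vec_index [measurable]:
  assumes "i < n"
  shows "(\<lambda>x. vec_index x i) \<in> borel_measurable (lborel_vec n)"
  unfolding lborel_vec_def
  by (rule measurable_embed_measure1)
     (use assms measurable_component_singleton[of i "{..<n}" "\<lambda>_. lborel :: real measure"] in simp)

lemma nn_integral_lborel_vec:
  assumes "g \<in> borel_measurable (lborel_vec n)"
  shows "nn_integral (lborel_vec n) g
    = (\<integral>\<^sup>+f. g (Matrix.vec n f) \<partial>(\<Pi>\<^sub>M i\<in>{..<n}. (lborel :: real measure)))"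
  using assms unfolding lborel_vec_def by (rule nn_integral_embed_measure'[OF inj_on_vec_PiM])

text \<open>On the space of \<open>M\<close>, \<open>f\<close> is the tuple of its coordinates, a
  map into the product space, followed by the embedding; both are measurable.\<close>

lemma measurable_lborel_vecI:
  assumes "\<And>x. x \<in> space M \<Longrightarrow> f x \<in> carrier_vec n"
    and "\<And>i. i < n \<Longrightarrow> (\<lambda>x. vec_index (f x) i) \<in> borel_measurable M"
  shows "f \<in> measurable M (lborel_vec n)"
proof -
  have "(\<lambda>x. \<lambda>i\<in>{..<n}. vec_index (f x) i) \<in> measurable M (\<Pi>\<^sub>M i\<in>{..<n}. (lborel :: real measure))"
    by (rule measurable_restrict) (use assms(2) in simp)
  from measurable_compose[OF this measurable_embed_measure2'[OF inj_on_vec_PiM]]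
  have "(\<lambda>x. Matrix.vec n (\<lambda>i\<in>{..<n}. vec_index (f x) i)) \<in> measurable M (lborel_vec n)"
    by (simp add: lborel_vec_def)
  moreover have "Matrix.vec n (\<lambda>i\<in>{..<n}. vec_index (f x) i) = f x" if "x \<in> space M" for x
    using assms(1)[OF that] by (intro eq_vecI) auto
  ultimately show ?thesis by (simp cong: measurable_cong)
qed

lemma measurable_mult_mat_vec:
  fixes A :: "real mat"
  assumes "A \<in> carrier_mat n k"
  shows "(\<lambda>x. A *\<^sub>v x) \<in> measurable (lborel_vec k) (lborel_vec n)"
proof (rule measurable_lborel_vecI)
  fix i assume i: "i < n"
  have "(\<lambda>x. \<Sum>j<k. A $$ (i,j) * vec_index x j) \<in> borel_measurable (lborel_vec k)"
    by (intro borel_measurable_sum borel_measurable_times measurable_vec_index) auto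
  then show "(\<lambda>x. vec_index (A *\<^sub>v x) i) \<in> borel_measurable (lborel_vec k)"
    by (rule measurable_cong[THEN iffD1, rotated])
       (use assms i in \<open>auto simp: scalar_prod_def atLeast0LessThan intro!: sum.cong\<close>)
qed (use assms in auto)

lemma quad_form_eq_sum:
  assumes "Q \<in> carrier_mat k k" "x \<in> carrier_vec k"
  shows "quad_form Q x = (\<Sum>i<k. \<Sum>j<k. Q $$ (i,j) * vec_index x i * vec_index x j)"
  using assms by (auto simp: scalar_prod_def atLeast0LessThan sum_distrib_left mult_ac intro!: sum.cong)

lemma measurable_quad_form:
  assumes "Q \<in> carrier_mat k k"
  shows "quad_form Q \<in> borel_measurable (lborel_vec k)"
proof -
  have "(\<lambda>x. \<Sum>i<k. \<Sum>j<k. Q $$ (i,j) * vec_index x i * vec_index x j) \<in> borel_measurable (lborel_vec k)"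
    by (intro borel_measurable_sum borel_measurable_times measurable_vec_index) auto
  then show ?thesis
    by (rule measurable_cong[THEN iffD1, rotated]) (use assms quad_form_eq_sum in auto)
qed

lemma measurable_vec_minus:
  fixes f g :: "'a \<Rightarrow> real Matrix.vec"
  assumes f: "f \<in> measurable M (lborel_vec k)" and g: "g \<in> measurable M (lborel_vec k)"
  shows "(\<lambda>x. f x - g x) \<in> measurable M (lborel_vec k)"
proof (rule measurable_lborel_vecI)
  fix i assume i: "i < k"
  have carr: "f x \<in> carrier_vec k" "g x \<in> carrier_vec k" if "x \<in> space M" for x
    using measurable_space[OF f that] measurable_space[OF g that] by auto
  have "(\<lambda>x. vec_index (f x) i - vec_index (g x) i) \<in> borel_measurable M"
    using measurable_compose[OF f measurable_vec_index[OF i]] measurable_compose[OF g measurable_vec_index[OF i]]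
    by (rule borel_measurable_diff)
  moreover have "vec_index (f x) i - vec_index (g x) i = vec_index (f x - g x) i" if "x \<in> space M" for x
    using carr(2)[OF that] i by simp
  ultimately show "(\<lambda>x. vec_index (f x - g x) i) \<in> borel_measurable M"
    by (simp cong: measurable_cong)
qed (use measurable_space[OF f] measurable_space[OF g] in auto)

lemma measurable_quad_form_shift:
  assumes "Q \<in> carrier_mat k k" "m \<in> carrier_vec k"
  shows "(\<lambda>x. quad_form Q (x - m)) \<in> borel_measurable (lborel_vec k)"
  by (rule measurable_compose[OF measurable_vec_minus measurable_quad_form[OF assms(1)]])
     (use assms(2) in \<open>auto intro!: measurable_const\<close>)

lemma pos_defD:
  assumes "pos_def k Q"
  shows "Q \<in> carrier_mat k k" "transpose_mat Q = Q"
    and "x \<in> carrier_vec k \<Longrightarrow> x \<noteq> 0\<^sub>v k \<Longrightarrow> 0 < quad_form Q x"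
  using assms by (auto simp: pos_def_def)

lemma pos_def_gauss:
  assumes Q: "pos_def k Q" and m: "m \<in> carrier_vec k"
  shows "0 < Determinant.det Q \<and>
    (\<integral>\<^sup>+x. ennreal (exp (- quad_form Q (x - m) / 2)) \<partial>lborel_vec k)
      = ennreal (sqrt ((2 * pi) ^ k / Determinant.det Q))"
proof -
  note Qc = pos_defD(1)[OF Q]
  \<comment> \<open>Extension by zero makes the symmetry hold for all index pairs, as the product
    space version requires.\<close>
  define q where "q i j = (if i < k \<and> j < k then Q $$ (i,j) else 0)" for i j
  have Qq: "Matrix.mat k k (\<lambda>(i,j). q i j) = Q"
    using Qc by (intro eq_matI) (auto simp: q_def)
  have form: "(\<Sum>i<k. \<Sum>j<k. q i j * x i * x j) = quad_form Q (Matrix.vec k x)" for x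
    by (subst quad_form_eq_sum[OF Qc]) (auto simp: q_def intro!: sum.cong)
  have "Q $$ (i,j) = Q $$ (j,i)" if "i < k" "j < k" for i j
    using pos_defD(2)[OF Q] Qc that by (metis carrier_matD index_transpose_mat(1))
  then have sym: "q i j = q j i" for i j by (auto simp: q_def)
  have pos: "0 < (\<Sum>i<k. \<Sum>j<k. q i j * x i * x j)" if "\<exists>i<k. x i \<noteq> 0" for x
  proof -
    from that obtain i where "i < k" "x i \<noteq> 0" by auto
    then have "Matrix.vec k x \<noteq> 0\<^sub>v k" by (metis index_vec index_zero_vec(1))
    then show ?thesis unfolding form by (intro pos_defD(3)[OF Q]) auto
  qed
  have "(\<integral>\<^sup>+x. ennreal (exp (- quad_form Q (x - m) / 2)) \<partial>lborel_vec k)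
    = (\<integral>\<^sup>+x. ennreal (exp (- quad_form Q (Matrix.vec k x - m) / 2)) \<partial>(\<Pi>\<^sub>M i\<in>{..<k}. (lborel :: real measure)))"
    using measurable_quad_form_shift[OF Qc m] by (intro nn_integral_lborel_vec) simp
  moreover have "Matrix.vec k x - m = Matrix.vec k (\<lambda>i. x i - vec_index m i)" for x
    using m by (intro eq_vecI) auto
  ultimately show ?thesis
    using nn_integral_gauss_PiM[of q k "vec_index m", OF sym pos] unfolding Qq form by simp
qed

section \<open>Inverse matrices, and normal densities written through the precision\<close>

lemma mat_inv_eqI:
  assumes A: "A \<in> carrier_mat k k" and B: "B \<in> carrier_mat k k" and AB: "A * B = 1\<^sub>m k"
  shows "mat_inv A = B"
proof (cases "mat_inverse A")
  \<comment> \<open>A right inverse of a square matrix is also a left inverse, so \<open>A\<close>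
    is a unit and this case is contradictory.\<close>
  case None
  have "B * A = 1\<^sub>m k" by (rule mat_mult_left_right_inverse[OF A B AB])
  then have "A \<in> Units (ring_mat TYPE(real) k ())"
    using A B AB by (auto simp: Units_def ring_mat_simps)
  with mat_inverse(1)[OF A None, of "()"] show ?thesis by simp
next
  case (Some C)
  note C = mat_inverse(2)[OF A Some]
  have "C = C * (A * B)" unfolding AB using right_mult_one_mat[of C k k] C by simp
  also have "\<dots> = (C * A) * B" using C A B by (intro assoc_mult_mat[symmetric]) auto
  also have "\<dots> = B" using left_mult_one_mat[of B k k] C B by simp
  finally show ?thesis using Some by (simp add: mat_inv_def)
qed

lemma mat_inv_invertible:
  assumes A: "A \<in> carrier_mat k k" and inv: "invertible_mat A"
  shows "mat_inv A \<in> carrier_mat k k" "A * mat_inv A = 1\<^sub>m k" "mat_inv A * A = 1\<^sub>m k"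
proof -
  from inv A obtain B where "A * B = 1\<^sub>m k" "B * A = 1\<^sub>m (dim_row B)"
    unfolding invertible_mat_def inverts_mat_def by auto
  moreover from this have B: "B \<in> carrier_mat k k"
    using A by (metis carrier_matD(2) carrier_matI index_mult_mat(3) index_one_mat(3))
  ultimately have "mat_inv A = B" using mat_inv_eqI[OF A B] by simp
  then show "mat_inv A \<in> carrier_mat k k" "A * mat_inv A = 1\<^sub>m k" "mat_inv A * A = 1\<^sub>m k"
    using \<open>A * B = 1\<^sub>m k\<close> \<open>B * A = 1\<^sub>m (dim_row B)\<close> B by auto
qed

text \<open>The normal density with the precision as its parameter: no inverse occurs in it, so
  multiplying such densities is algebra of quadratic forms and determinants.\<close>

definition gauss_density :: "real mat \<Rightarrow> real Matrix.vec \<Rightarrow> real Matrix.vec \<Rightarrow> real" where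
  "gauss_density Q m x = exp (- quad_form Q (x - m) / 2) * sqrt (Determinant.det Q / (2 * pi) ^ dim_vec m)"

text \<open>The bridge from covariances to precisions. Exhibiting a right inverse \<open>Q\<close>
  of \<open>S\<close> spares any computation with \<open>mat_inv S\<close>, and the two determinants
  are reciprocal.\<close>

lemma mvn_density_eq_gauss:
  assumes S: "S \<in> carrier_mat k k" and Q: "Q \<in> carrier_mat k k" and SQ: "S * Q = 1\<^sub>m k"
    and m: "m \<in> carrier_vec k"
  shows "mvn_density m S x = gauss_density Q m x"
proof -
  have "Determinant.det S * Determinant.det Q = 1"
    using det_mult[OF S Q] SQ by simp
  then have "Determinant.det S = inverse (Determinant.det Q)"
    by (metis inverse_unique mult.commute)
  then have "1 / sqrt ((2 * pi) ^ dim_vec m * Determinant.det S) = sqrt (1 / ((2 * pi) ^ dim_vec m * inverse (Determinant.det Q)))"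
    by (simp only: real_sqrt_divide real_sqrt_one)
  also have "1 / ((2 * pi) ^ dim_vec m * inverse (Determinant.det Q)) = Determinant.det Q / (2 * pi) ^ dim_vec m"
    by (simp add: divide_inverse)
  finally show ?thesis
    unfolding mvn_density_def gauss_density_def mat_inv_eqI[OF S Q SQ] by (metis mult.right_neutral times_divide_eq_right)
qed

text \<open>Mean and argument may both vary: in the likelihood and in the predictive integrand it is
  the mean that moves with the coefficients, while the argument is fixed.\<close>

lemma measurable_gauss_density:
  assumes "Q \<in> carrier_mat k k" "f \<in> measurable M (lborel_vec k)" "g \<in> measurable M (lborel_vec k)"
  shows "(\<lambda>x. gauss_density Q (f x) (g x)) \<in> borel_measurable M"
proof -
  have "(\<lambda>x. exp (- quad_form Q (g x - f x) / 2) * sqrt (Determinant.det Q / (2 * pi) ^ k)) \<in> borel_measurable M"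
    using measurable_compose[OF measurable_vec_minus[OF assms(3,2)] measurable_quad_form[OF assms(1)]]
    by simp
  moreover have "dim_vec (f x) = k" if "x \<in> space M" for x
    using measurable_space[OF assms(2) that] by simp
  ultimately show ?thesis
    by (simp add: gauss_density_def cong: measurable_cong)
qed

lemma gauss_density_nonneg: "0 \<le> Determinant.det Q \<Longrightarrow> 0 \<le> gauss_density Q m x"
  by (simp add: gauss_density_def)

lemma nn_integral_gauss_density:
  assumes Q: "pos_def k Q" and m: "m \<in> carrier_vec k"
  shows "(\<integral>\<^sup>+x. ennreal (gauss_density Q m x) \<partial>lborel_vec k) = 1"
proof -
  note g = pos_def_gauss[OF Q m]
  note meas = measurable_quad_form_shift[OF pos_defD(1)[OF Q] m]
  have "(\<integral>\<^sup>+x. ennreal (gauss_density Q m x) \<partial>lborel_vec k)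
    = (\<integral>\<^sup>+x. ennreal (exp (- quad_form Q (x - m) / 2)) * ennreal (sqrt (Determinant.det Q / (2 * pi) ^ k)) \<partial>lborel_vec k)"
    using g m by (simp add: gauss_density_def ennreal_mult')
  also have "\<dots> = ennreal (sqrt ((2 * pi) ^ k / Determinant.det Q)) * ennreal (sqrt (Determinant.det Q / (2 * pi) ^ k))"
    using g meas by (subst nn_integral_multc) auto
  also have "\<dots> = ennreal (sqrt ((2 * pi) ^ k / Determinant.det Q) * sqrt (Determinant.det Q / (2 * pi) ^ k))"
    by (rule ennreal_mult'[symmetric]) (use g in simp)
  also have "\<dots> = 1" using g by (simp flip: real_sqrt_mult)
  finally show ?thesis .
qed

lemma space_mvn [simp]: "m \<in> carrier_vec k \<Longrightarrow> space (mvn m S) = carrier_vec k"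
  and sets_mvn [simp]: "m \<in> carrier_vec k \<Longrightarrow> sets (mvn m S) = sets (lborel_vec k)"
  by (auto simp: mvn_def)

lemma prob_space_mvn:
  assumes Q: "pos_def k Q" and m: "m \<in> carrier_vec k"
    and S: "S \<in> carrier_mat k k" and SQ: "S * Q = 1\<^sub>m k"
  shows "prob_space (mvn m S)"
proof
  have "(\<lambda>x. ennreal (gauss_density Q m x)) \<in> borel_measurable (lborel_vec k)"
    by (rule measurable_compose[OF measurable_gauss_density[OF pos_defD(1)[OF Q]] measurable_ennreal])
       (use m in simp_all)
  then have "emeasure (mvn m S) (space (mvn m S))
      = (\<integral>\<^sup>+x. ennreal (gauss_density Q m x) * indicator (space (lborel_vec k)) x \<partial>lborel_vec k)"
    using m by (simp add: mvn_def emeasure_density mvn_density_eq_gauss[OF S pos_defD(1)[OF Q] SQ m])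
  also have "\<dots> = (\<integral>\<^sup>+x. ennreal (gauss_density Q m x) \<partial>lborel_vec k)"
    by (rule nn_integral_cong) (simp add: indicator_def)
  finally show "emeasure (mvn m S) (space (mvn m S)) = 1"
    by (simp add: nn_integral_gauss_density[OF Q m])
qed

section \<open>Linear Gaussian marginalization\<close>

lemma scalar_prod_self_nonneg: "0 \<le> scalar_prod (v :: real Matrix.vec) v"
  by (auto simp: scalar_prod_def intro!: sum_nonneg)

lemma scalar_prod_self_eq_0:
  assumes "(v :: real Matrix.vec) \<in> carrier_vec n" "scalar_prod v v = 0"
  shows "v = 0\<^sub>v n"
proof (rule eq_vecI)
  fix i assume "i < dim_vec (0\<^sub>v n :: real Matrix.vec)"
  then have i: "i \<in> {0..<dim_vec v}" using assms(1) by simp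
  have "(\<Sum>i\<in>{0..<dim_vec v}. vec_index v i * vec_index v i) = 0"
    using assms(2) by (simp add: scalar_prod_def)
  with i have "vec_index v i * vec_index v i = 0"
    by (subst (asm) sum_nonneg_eq_0_iff) auto
  then show "vec_index v i = vec_index (0\<^sub>v n) i" using i assms(1) by simp
qed (use assms in simp)

lemma scalar_prod_mult_mat_vec:
  fixes A :: "real mat"
  assumes "A \<in> carrier_mat n k" "x \<in> carrier_vec n" "u \<in> carrier_vec k"
  shows "scalar_prod x (A *\<^sub>v u) = scalar_prod (transpose_mat A *\<^sub>v x) u"
  using transpose_vec_mult_scalar[OF assms(1,3,2)] assms
  by (metis comm_scalar_prod mult_mat_vec_carrier transpose_carrier_mat)

lemma smult_mult_mat_vec:
  fixes A :: "real mat"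
  assumes "A \<in> carrier_mat n k" "x \<in> carrier_vec k"
  shows "(c \<cdot>\<^sub>m A) *\<^sub>v x = c \<cdot>\<^sub>v (A *\<^sub>v x)"
  using assms by (intro eq_vecI) auto

lemma mult_mat_zero_vec:
  fixes A :: "real mat"
  assumes "A \<in> carrier_mat n k"
  shows "A *\<^sub>v 0\<^sub>v k = 0\<^sub>v n"
  using assms by (intro eq_vecI) auto

lemma transpose_smult: "transpose_mat (c \<cdot>\<^sub>m A) = c \<cdot>\<^sub>m transpose_mat A"
  by (intro eq_matI) auto

lemma mat_eqI_mult_vec:
  fixes A B :: "real mat"
  assumes A: "A \<in> carrier_mat n k" and B: "B \<in> carrier_mat n k"
    and eq: "\<And>x. x \<in> carrier_vec k \<Longrightarrow> A *\<^sub>v x = B *\<^sub>v x"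
  shows "A = B"
proof (rule eq_matI)
  fix i j assume "i < dim_row B" "j < dim_col B"
  then show "A $$ (i,j) = B $$ (i,j)"
    using arg_cong[OF eq[of "unit_vec k j"], of "\<lambda>v. vec_index v i"] A B by simp
qed (use A B in auto)

lemma pos_def_smult:
  assumes "pos_def k Q" "c > 0"
  shows "pos_def k (c \<cdot>\<^sub>m Q)"
proof -
  note Q = pos_defD[OF assms(1)]
  have "quad_form (c \<cdot>\<^sub>m Q) x = c * quad_form Q x" if "x \<in> carrier_vec k" for x
    using that Q(1) by (simp add: smult_mult_mat_vec[OF Q(1) that])
  then show ?thesis
    using Q assms(2) by (auto simp: pos_def_def transpose_smult)
qed

text \<open>Invertibility comes from the positive determinant supplied by the Gaussian integral. For
  the symmetry of the inverse \<open>R\<close>, transposing \<open>Q * R = 1\<close> shows that the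
  transpose of \<open>R\<close> is a left inverse of \<open>Q\<close>; multiplied by
  \<open>Q * R\<close> it becomes \<open>R\<close>.\<close>

lemma pos_def_mat_inv:
  assumes "pos_def k Q"
  shows "mat_inv Q \<in> carrier_mat k k" "Q * mat_inv Q = 1\<^sub>m k" "mat_inv Q * Q = 1\<^sub>m k"
    and "transpose_mat (mat_inv Q) = mat_inv Q"
proof -
  note Q = pos_defD[OF assms]
  have "Determinant.det Q \<noteq> 0"
    using pos_def_gauss[OF assms zero_carrier_vec] by simp
  from det_non_zero_imp_unit[OF Q(1) this, of "()"] obtain R where
    R: "R \<in> carrier_mat k k" "Q * R = 1\<^sub>m k" "R * Q = 1\<^sub>m k"
    by (auto simp: Units_def ring_mat_simps)
  have QR: "mat_inv Q = R" by (rule mat_inv_eqI[OF Q(1) R(1,2)])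
  have "transpose_mat R * Q = 1\<^sub>m k"
    using transpose_mult[OF Q(1) R(1)] R Q(2) by simp
  moreover have "transpose_mat R = transpose_mat R * (Q * R)"
    unfolding R(2) by (rule right_mult_one_mat[symmetric, of _ k]) (use R in simp)
  moreover have "transpose_mat R * (Q * R) = (transpose_mat R * Q) * R"
    by (rule assoc_mult_mat[symmetric, of _ k k _ k _ k]) (use R Q in auto)
  ultimately have "transpose_mat R = R"
    using left_mult_one_mat[OF R(1)] by simp
  with R show "mat_inv Q \<in> carrier_mat k k" "Q * mat_inv Q = 1\<^sub>m k" "mat_inv Q * Q = 1\<^sub>m k"
    "transpose_mat (mat_inv Q) = mat_inv Q"
    unfolding QR by simp_all
qed

lemma pos_def_one: "pos_def n (1\<^sub>m n)"
proof -
  have "0 < scalar_prod x x" if "x \<in> carrier_vec n" "x \<noteq> 0\<^sub>v n" for x :: "real Matrix.vec"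
    using scalar_prod_self_nonneg[of x] scalar_prod_self_eq_0[OF that(1)] that(2) by linarith
  then show ?thesis by (auto simp: pos_def_def)
qed

text \<open>The form at \<open>x\<close> is the squared norm of \<open>B x\<close>. If it vanishes,
  so does the Gram matrix applied to \<open>x\<close>, and invertibility forces
  \<open>x = 0\<close>.\<close>

lemma pos_def_gram:
  assumes "invertible_mat (transpose_mat B * B)" and B: "B \<in> carrier_mat n k"
  shows "pos_def k (transpose_mat B * B)"
proof -
  let ?G = "transpose_mat B * B"
  have G: "?G \<in> carrier_mat k k" using B by auto
  have form: "quad_form ?G x = scalar_prod (B *\<^sub>v x) (B *\<^sub>v x)" if x: "x \<in> carrier_vec k" for x
  proof -
    have "?G *\<^sub>v x = transpose_mat B *\<^sub>v (B *\<^sub>v x)"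
      by (rule assoc_mult_mat_vec) (use B x in auto)
    then show ?thesis
      using scalar_prod_mult_mat_vec[of "transpose_mat B" k n x "B *\<^sub>v x"] B x by simp
  qed
  have "0 < quad_form ?G x" if x: "x \<in> carrier_vec k" "x \<noteq> 0\<^sub>v k" for x
  proof (rule ccontr)
    assume "\<not> 0 < quad_form ?G x"
    then have "scalar_prod (B *\<^sub>v x) (B *\<^sub>v x) = 0"
      using form[OF x(1)] scalar_prod_self_nonneg[of "B *\<^sub>v x"] by linarith
    then have "B *\<^sub>v x = 0\<^sub>v n"
      by (intro scalar_prod_self_eq_0) (use B x in auto)
    then have Gx: "?G *\<^sub>v x = 0\<^sub>v k"
      using B x assoc_mult_mat_vec[of "transpose_mat B" k n B k x]
        mult_mat_zero_vec[of "transpose_mat B" k n] by simp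
    have "x = (mat_inv ?G * ?G) *\<^sub>v x"
      unfolding mat_inv_invertible(3)[OF G assms(1)] using x by simp
    also have "\<dots> = mat_inv ?G *\<^sub>v (?G *\<^sub>v x)"
      by (rule assoc_mult_mat_vec[of _ k k _ k]) (use x G mat_inv_invertible(1)[OF G assms(1)] in auto)
    also have "\<dots> = 0\<^sub>v k"
      unfolding Gx by (rule mult_mat_zero_vec[OF mat_inv_invertible(1)[OF G assms(1)]])
    finally show False using x by simp
  qed
  moreover have "transpose_mat ?G = ?G"
    using B by (subst transpose_mult[of _ k n _ k]) auto
  ultimately show ?thesis using G by (auto simp: pos_def_def)
qed

text \<open>The setting is an observation \<open>A b\<close> plus isotropic noise of precision
  \<open>w\<close>, with \<open>b\<close> normal of precision \<open>P\<close>. It will be used for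
  prediction: \<open>A\<close> holds the columns of the new design, \<open>b\<close> the
  coefficients after the update, and \<open>w\<close> is \<open>1 / \<sigma>\<^sup>2\<close>.
  \<open>H\<close> is the precision of \<open>b\<close> given the observation.\<close>

locale linear_gaussian =
  fixes d s :: nat and A P :: "real mat" and w :: real
  assumes A: "A \<in> carrier_mat d s" and P: "pos_def s P" and w: "w > 0"
begin

definition H :: "real mat" where "H = w \<cdot>\<^sub>m (transpose_mat A * A) + P"

text \<open>Woodbury's formula for the inverse of \<open>(1/w) I + A P^-1 A^T\<close>, the
  covariance of the observation. Its quadratic form at \<open>r\<close> is the minimum over
  \<open>u\<close> of \<open>w * |r - A u|^2 + u^T P u\<close>.\<close>

definition M :: "real mat" where
  "M = w \<cdot>\<^sub>m 1\<^sub>m d - w\<^sup>2 \<cdot>\<^sub>m (A * mat_inv H * transpose_mat A)"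

(* The minimizer over u of w * |r - A u|^2 + u^T P u. *)
definition argmin :: "real Matrix.vec \<Rightarrow> real Matrix.vec" where
  "argmin r = mat_inv H *\<^sub>v (w \<cdot>\<^sub>v (transpose_mat A *\<^sub>v r))"

lemmas P_carrier = pos_defD(1)[OF P]

lemma H_carrier: "H \<in> carrier_mat s s"
  using A P_carrier by (auto simp: H_def)

lemma H_mult_vec:
  assumes "x \<in> carrier_vec s"
  shows "H *\<^sub>v x = w \<cdot>\<^sub>v (transpose_mat A *\<^sub>v (A *\<^sub>v x)) + P *\<^sub>v x"
proof -
  have "H *\<^sub>v x = (w \<cdot>\<^sub>m (transpose_mat A * A)) *\<^sub>v x + P *\<^sub>v x"
    unfolding H_def by (rule add_mult_distrib_mat_vec) (use A P_carrier assms in auto)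
  then show ?thesis
    using A assms by (simp add: smult_mult_mat_vec[of _ s s] assoc_mult_mat_vec[of _ s d])
qed

lemma quad_form_H:
  assumes x: "x \<in> carrier_vec s"
  shows "quad_form H x = w * scalar_prod (A *\<^sub>v x) (A *\<^sub>v x) + quad_form P x"
proof -
  have "quad_form H x = scalar_prod x (w \<cdot>\<^sub>v (transpose_mat A *\<^sub>v (A *\<^sub>v x))) + quad_form P x"
    unfolding H_mult_vec[OF x] by (rule scalar_prod_add_distrib) (use A P_carrier x in auto)
  also have "scalar_prod x (w \<cdot>\<^sub>v (transpose_mat A *\<^sub>v (A *\<^sub>v x))) = w * scalar_prod (A *\<^sub>v x) (A *\<^sub>v x)"
    using scalar_prod_mult_mat_vec[of "transpose_mat A" s d x "A *\<^sub>v x"] A x by simp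
  finally show ?thesis .
qed

lemma pos_def_H: "pos_def s H"
proof -
  have "transpose_mat (transpose_mat A * A) = transpose_mat A * A"
    using A by (subst transpose_mult[of _ s d _ s]) auto
  then have "transpose_mat H = H"
    unfolding H_def using A P_carrier pos_defD(2)[OF P]
    by (subst transpose_add[of _ s s]) (auto simp: transpose_smult)
  moreover have "0 < quad_form H x" if x: "x \<in> carrier_vec s" "x \<noteq> 0\<^sub>v s" for x
    using pos_defD(3)[OF P x] w scalar_prod_self_nonneg[of "A *\<^sub>v x"]
    unfolding quad_form_H[OF x(1)] by (simp add: add_nonneg_pos)
  ultimately show ?thesis using H_carrier by (auto simp: pos_def_def)
qed

lemma argmin_carrier: "r \<in> carrier_vec d \<Longrightarrow> argmin r \<in> carrier_vec s"
  using A pos_def_mat_inv(1)[OF pos_def_H] by (auto simp: argmin_def)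

lemma H_argmin:
  assumes r: "r \<in> carrier_vec d"
  shows "H *\<^sub>v argmin r = w \<cdot>\<^sub>v (transpose_mat A *\<^sub>v r)"
proof -
  have v: "w \<cdot>\<^sub>v (transpose_mat A *\<^sub>v r) \<in> carrier_vec s" using A r by auto
  have "H *\<^sub>v argmin r = (H * mat_inv H) *\<^sub>v (w \<cdot>\<^sub>v (transpose_mat A *\<^sub>v r))"
    unfolding argmin_def
    by (rule assoc_mult_mat_vec[symmetric, OF H_carrier pos_def_mat_inv(1)[OF pos_def_H] v])
  then show ?thesis using v pos_def_mat_inv(2)[OF pos_def_H] by simp
qed

lemma M_carrier: "M \<in> carrier_mat d d"
  using A pos_def_mat_inv(1)[OF pos_def_H] by (auto simp: M_def)

text \<open>Lets \<open>complete_square\<close> and \<open>cov_mult_M\<close> treat \<open>M\<close>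
  as \<open>w\<close> times the residual of the penalized fit, without unfolding the Woodbury
  expression.\<close>

lemma M_mult_vec:
  assumes r: "r \<in> carrier_vec d"
  shows "M *\<^sub>v r = w \<cdot>\<^sub>v (r - A *\<^sub>v argmin r)"
proof -
  note Hi = pos_def_mat_inv(1)[OF pos_def_H]
  have "M *\<^sub>v r = (w \<cdot>\<^sub>m 1\<^sub>m d) *\<^sub>v r - (w\<^sup>2 \<cdot>\<^sub>m (A * mat_inv H * transpose_mat A)) *\<^sub>v r"
    unfolding M_def by (rule minus_mult_distrib_mat_vec) (use A Hi r in auto)
  moreover have "(A * mat_inv H * transpose_mat A) *\<^sub>v r = A *\<^sub>v (mat_inv H *\<^sub>v (transpose_mat A *\<^sub>v r))"
    using A Hi r by (simp add: assoc_mult_mat_vec[of _ d s _ d] assoc_mult_mat_vec[of _ s s _ d])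
  moreover have "A *\<^sub>v argmin r = w \<cdot>\<^sub>v (A *\<^sub>v (mat_inv H *\<^sub>v (transpose_mat A *\<^sub>v r)))"
    using A Hi r by (simp add: argmin_def mult_mat_vec[of _ s s] mult_mat_vec[of _ d s])
  moreover have "A *\<^sub>v (mat_inv H *\<^sub>v (transpose_mat A *\<^sub>v r)) \<in> carrier_vec d"
    using A Hi r by auto
  ultimately show ?thesis
    using A Hi r by (simp add: smult_mult_mat_vec[of _ d d])
      (intro eq_vecI, auto simp: algebra_simps power2_eq_square)
qed

text \<open>With \<open>z = argmin r\<close>, the normal equation \<open>H_argmin\<close> turns the
  linear term \<open>- 2 w <A u, r>\<close> into \<open>- 2 <u, H z>\<close>, so the quadratic is
  centred at \<open>z\<close>. The constant left over is \<open>w <r, r> - w <r, A z>\<close>, which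
  is \<open>quad_form M r\<close>.\<close>

lemma complete_square:
  assumes r: "r \<in> carrier_vec d" and u: "u \<in> carrier_vec s"
  shows "w * scalar_prod (r - A *\<^sub>v u) (r - A *\<^sub>v u) + quad_form P u
    = quad_form M r + quad_form H (u - argmin r)"
proof -
  define z where "z = argmin r"
  have z: "z \<in> carrier_vec s" unfolding z_def by (rule argmin_carrier[OF r])
  have Au: "A *\<^sub>v u \<in> carrier_vec d" and Az: "A *\<^sub>v z \<in> carrier_vec d" using A u z by auto
  have Hz: "scalar_prod x (H *\<^sub>v z) = w * scalar_prod (A *\<^sub>v x) r" if x: "x \<in> carrier_vec s" for x
    using scalar_prod_mult_mat_vec[of "transpose_mat A" s d x r] H_argmin[OF r] A x r by (simp add: z_def)
  have Hu: "scalar_prod z (H *\<^sub>v u) = scalar_prod u (H *\<^sub>v z)"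
    using scalar_prod_mult_mat_vec[OF H_carrier z u] pos_defD(2)[OF pos_def_H] H_carrier z u
    by (simp add: comm_scalar_prod[of u s])
  have "H *\<^sub>v (u - z) = H *\<^sub>v u - H *\<^sub>v z"
    by (rule mult_minus_distrib_mat_vec[OF H_carrier u z])
  then have "quad_form H (u - z) = quad_form H u - 2 * scalar_prod u (H *\<^sub>v z) + quad_form H z"
    using H_carrier u z Hu
    by (simp add: minus_scalar_prod_distrib[of _ s] scalar_prod_minus_distrib[of _ s])
  moreover have "quad_form M r = w * scalar_prod r r - w * scalar_prod r (A *\<^sub>v z)"
    unfolding M_mult_vec[OF r] z_def[symmetric] using r Az
    by (simp add: scalar_prod_minus_distrib[of _ d] algebra_simps)
  moreover have "w * scalar_prod (r - A *\<^sub>v u) (r - A *\<^sub>v u)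
      = w * (scalar_prod r r - 2 * scalar_prod (A *\<^sub>v u) r + scalar_prod (A *\<^sub>v u) (A *\<^sub>v u))"
    using r Au by (simp add: minus_scalar_prod_distrib[of _ d] scalar_prod_minus_distrib[of _ d]
        comm_scalar_prod[of r d "A *\<^sub>v u"])
  moreover have "scalar_prod r (A *\<^sub>v z) = scalar_prod (A *\<^sub>v z) r"
    by (rule comm_scalar_prod[OF r Az])
  ultimately show ?thesis
    unfolding z_def[symmetric] quad_form_H[OF u] Hz[OF u] Hz[OF z] by (simp add: algebra_simps)
qed

text \<open>Taking \<open>u = argmin r\<close> in \<open>complete_square\<close> writes the form as
  a sum of two nonnegative terms. If the minimizer is nonzero, its \<open>P\<close> term is
  positive; otherwise the fit term is \<open>w\<close> times the squared norm of
  \<open>r\<close>.\<close>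

lemma pos_def_M: "pos_def d M"
proof -
  note Hi = pos_def_mat_inv[OF pos_def_H]
  have "transpose_mat (A * mat_inv H * transpose_mat A) = A * (mat_inv H * transpose_mat A)"
    using A Hi by (simp add: transpose_mult[of _ d s _ d] transpose_mult[of _ s s _ d])
  also have "\<dots> = A * mat_inv H * transpose_mat A"
    by (rule assoc_mult_mat[symmetric]) (use A Hi in auto)
  finally have "transpose_mat M = M"
    unfolding M_def using A Hi
    by (subst transpose_minus[of _ d d]) (auto simp: transpose_smult)
  moreover have "0 < quad_form M r" if r: "r \<in> carrier_vec d" "r \<noteq> 0\<^sub>v d" for r
  proof -
    define z where "z = argmin r"
    have z: "z \<in> carrier_vec s" unfolding z_def by (rule argmin_carrier[OF r(1)])
    have "quad_form H (z - z) = 0"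
      using z H_carrier by (simp add: mult_mat_zero_vec)
    then have M: "quad_form M r = w * scalar_prod (r - A *\<^sub>v z) (r - A *\<^sub>v z) + quad_form P z"
      using complete_square[OF r(1) z] by (simp add: z_def)
    have nonneg: "0 \<le> w * scalar_prod (r - A *\<^sub>v z) (r - A *\<^sub>v z)"
      using w scalar_prod_self_nonneg[of "r - A *\<^sub>v z"] by simp
    show ?thesis
    proof (cases "z = 0\<^sub>v s")
      case True
      then have "r - A *\<^sub>v z = r" using A r by (simp add: mult_mat_zero_vec)
      moreover have "scalar_prod r r \<noteq> 0" using scalar_prod_self_eq_0[OF r(1)] r(2) by auto
      moreover have "quad_form P z = 0" using True P_carrier by (simp add: mult_mat_zero_vec)
      ultimately show ?thesis using M w scalar_prod_self_nonneg[of r] by simp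
    next
      case False
      from pos_defD(3)[OF P z this] M nonneg show ?thesis by simp
    qed
  qed
  ultimately show ?thesis using M_carrier by (auto simp: pos_def_def)
qed

text \<open>The covariance is prescribed by its action on vectors, so that it may be given in any
  form. With \<open>z = argmin r\<close>, the normal equation says \<open>A^T M r = P z\<close>;
  hence \<open>S M r = (r - A z) + A P^-1 P z = r\<close>.\<close>

lemma cov_mult_M:
  assumes S: "S \<in> carrier_mat d d"
    and S_vec: "\<And>v. v \<in> carrier_vec d \<Longrightarrow>
      S *\<^sub>v v = (1 / w) \<cdot>\<^sub>v v + A *\<^sub>v (mat_inv P *\<^sub>v (transpose_mat A *\<^sub>v v))"
  shows "S * M = 1\<^sub>m d"
proof (rule mat_eqI_mult_vec[of _ d d])
  fix r :: "real Matrix.vec" assume r: "r \<in> carrier_vec d"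
  note Pi = pos_def_mat_inv[OF P]
  define z where "z = argmin r"
  have z: "z \<in> carrier_vec s" unfolding z_def by (rule argmin_carrier[OF r])
  have Az: "A *\<^sub>v z \<in> carrier_vec d" using A z by auto
  define x where "x = w \<cdot>\<^sub>v (transpose_mat A *\<^sub>v (A *\<^sub>v z))"
  have x: "x \<in> carrier_vec s" using A Az by (auto simp: x_def)
  have eq: "x + P *\<^sub>v z = w \<cdot>\<^sub>v (transpose_mat A *\<^sub>v r)"
    using H_argmin[OF r] H_mult_vec[OF z] by (simp add: z_def x_def)
  have "P *\<^sub>v z = w \<cdot>\<^sub>v (transpose_mat A *\<^sub>v r) - x"
    unfolding eq[symmetric] using x P_carrier by (intro eq_vecI) auto
  also have "\<dots> = w \<cdot>\<^sub>v (transpose_mat A *\<^sub>v r - transpose_mat A *\<^sub>v (A *\<^sub>v z))"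
    unfolding x_def using A r Az by (intro eq_vecI) (auto simp: algebra_simps)
  also have "transpose_mat A *\<^sub>v r - transpose_mat A *\<^sub>v (A *\<^sub>v z) = transpose_mat A *\<^sub>v (r - A *\<^sub>v z)"
    by (rule mult_minus_distrib_mat_vec[symmetric]) (use A r Az in auto)
  also have "w \<cdot>\<^sub>v \<dots> = transpose_mat A *\<^sub>v (w \<cdot>\<^sub>v (r - A *\<^sub>v z))"
    by (rule mult_mat_vec[symmetric]) (use A r Az in auto)
  finally have *: "transpose_mat A *\<^sub>v (w \<cdot>\<^sub>v (r - A *\<^sub>v z)) = P *\<^sub>v z" ..
  have "mat_inv P *\<^sub>v (P *\<^sub>v z) = z"
    using assoc_mult_mat_vec[OF Pi(1) P_carrier z] Pi(3) z by simp
  then have "S *\<^sub>v (M *\<^sub>v r) = (1 / w) \<cdot>\<^sub>v (w \<cdot>\<^sub>v (r - A *\<^sub>v z)) + A *\<^sub>v z"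
    using S_vec[OF mult_mat_vec_carrier[OF M_carrier r]] M_mult_vec[OF r] * by (simp add: z_def)
  also have "(1 / w) \<cdot>\<^sub>v (w \<cdot>\<^sub>v (r - v)) + v = r" if "v \<in> carrier_vec d" for v
    using w r that by (intro eq_vecI) auto
  note this[OF Az]
  finally show "(S * M) *\<^sub>v r = 1\<^sub>m d *\<^sub>v r"
    using assoc_mult_mat_vec[OF S M_carrier r] r by simp
qed (use S M_carrier in auto)

text \<open>Both sides are the determinant of \<open>?K\<close>, which for centred \<open>b\<close>
  is the joint precision of the observation and \<open>- b\<close>. Clearing the lower left block by
  row operations (\<open>?L\<close>) leaves \<open>P\<close>, clearing it by column operations
  (\<open>?R\<close>) leaves \<open>M\<close> beside \<open>H\<close>; both operations have
  determinant 1.\<close>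

lemma det_P_eq: "w ^ d * Determinant.det P = Determinant.det M * Determinant.det H"
proof -
  note Hi = pos_def_mat_inv[OF pos_def_H]
  let ?At = "transpose_mat A"
  let ?K = "four_block_mat (w \<cdot>\<^sub>m 1\<^sub>m d) (w \<cdot>\<^sub>m A) (w \<cdot>\<^sub>m ?At) H"
  let ?L = "four_block_mat (1\<^sub>m d) (0\<^sub>m d s) (- ?At) (1\<^sub>m s)"
  let ?R = "four_block_mat (1\<^sub>m d) (0\<^sub>m d s) (- w \<cdot>\<^sub>m (mat_inv H * ?At)) (1\<^sub>m s)"
  have "?L * ?K = four_block_mat (w \<cdot>\<^sub>m 1\<^sub>m d) (w \<cdot>\<^sub>m A) (0\<^sub>m s d) P"
  proof (subst mult_four_block_mat[of _ d d _ s _ s _ _ d _ s], goal_cases)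
    case 9
    have "- ?At * (w \<cdot>\<^sub>m A) = - (w \<cdot>\<^sub>m (?At * A))"
      using A by (simp add: mult_smult_distrib[of _ s d]) (intro eq_matI, auto)
    then have "- ?At * (w \<cdot>\<^sub>m A) + 1\<^sub>m s * H = P"
      using A P_carrier by (simp add: left_mult_one_mat[OF H_carrier]) (intro eq_matI, auto simp: H_def)
    moreover have "- ?At * (w \<cdot>\<^sub>m 1\<^sub>m d) + 1\<^sub>m s * (w \<cdot>\<^sub>m ?At) = 0\<^sub>m s d"
      using A by (simp add: mult_smult_distrib[of _ s d _ d]) (intro eq_matI, auto)
    ultimately show ?case
      using A H_carrier by (intro cong_four_block_mat) auto
  qed (use A H_carrier in auto)
  moreover have "?K * ?R = four_block_mat M (w \<cdot>\<^sub>m A) (0\<^sub>m s d) H"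
  proof (subst mult_four_block_mat[of _ d d _ s _ s _ _ d _ s], goal_cases)
    case 9
    have "(w \<cdot>\<^sub>m A) * (- w \<cdot>\<^sub>m (mat_inv H * ?At)) = - (w\<^sup>2 \<cdot>\<^sub>m (A * mat_inv H * ?At))"
      using A Hi(1) by (simp add: mult_smult_distrib[of _ d s _ d] mult_smult_assoc_mat[of _ d s _ d])
        (intro eq_matI, auto simp: power2_eq_square)
    then have "(w \<cdot>\<^sub>m 1\<^sub>m d) * 1\<^sub>m d + (w \<cdot>\<^sub>m A) * (- w \<cdot>\<^sub>m (mat_inv H * ?At)) = M"
      using A Hi(1) by (simp add: M_def) (intro eq_matI, auto)
    moreover have "H * (- w \<cdot>\<^sub>m (mat_inv H * ?At)) = - w \<cdot>\<^sub>m ?At"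
    proof -
      have "H * (mat_inv H * ?At) = (H * mat_inv H) * ?At"
        by (rule assoc_mult_mat[symmetric, of _ s s _ s _ d]) (use A Hi H_carrier in auto)
      then show ?thesis
        using A Hi H_carrier by (simp add: mult_smult_distrib[of _ s s _ d])
    qed
    moreover have "(w \<cdot>\<^sub>m ?At) * 1\<^sub>m d + - w \<cdot>\<^sub>m ?At = 0\<^sub>m s d"
      using A by (intro eq_matI) auto
    ultimately show ?case
      using A Hi(1) H_carrier by (intro cong_four_block_mat) auto
  qed (use A H_carrier Hi in auto)
  moreover have "Determinant.det (?L * ?K) = Determinant.det ?L * Determinant.det ?K"
    by (rule det_mult[of _ "d + s"]) (use A H_carrier in auto)
  moreover have "Determinant.det (?K * ?R) = Determinant.det ?K * Determinant.det ?R"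
    by (rule det_mult[of _ "d + s"]) (use A H_carrier Hi in auto)
  moreover have "Determinant.det ?L = 1"
    by (subst det_four_block_mat_upper_right_zero[of _ d _ s]) (use A in auto)
  moreover have "Determinant.det ?R = 1"
    by (subst det_four_block_mat_upper_right_zero[of _ d _ s]) (use A Hi in auto)
  moreover have "Determinant.det (four_block_mat (w \<cdot>\<^sub>m 1\<^sub>m d) (w \<cdot>\<^sub>m A) (0\<^sub>m s d) P) = w ^ d * Determinant.det P"
    by (subst det_four_block_mat_lower_left_zero[of _ d _ s]) (use A P_carrier in auto)
  moreover have "Determinant.det (four_block_mat M (w \<cdot>\<^sub>m A) (0\<^sub>m s d) H) = Determinant.det M * Determinant.det H"
    by (subst det_four_block_mat_lower_left_zero[of _ d _ s]) (use A M_carrier H_carrier in auto)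
  ultimately show ?thesis by simp
qed

text \<open>After centring, the exponent is the left side of \<open>complete_square\<close> with
  \<open>r = y - A m\<close> and \<open>u = b - m\<close>. The part depending on \<open>b\<close> is
  a Gaussian of precision \<open>H\<close>, and \<open>det_P_eq\<close> trades the determinants of
  \<open>P\<close> and \<open>H\<close> for that of \<open>M\<close>.\<close>

lemma nn_integral_marginal:
  assumes m: "m \<in> carrier_vec s" and y: "y \<in> carrier_vec d"
  shows "(\<integral>\<^sup>+b. ennreal (gauss_density (w \<cdot>\<^sub>m 1\<^sub>m d) (A *\<^sub>v b) y * gauss_density P m b) \<partial>lborel_vec s)
    = ennreal (gauss_density M (A *\<^sub>v m) y)"
proof -
  define r where "r = y - A *\<^sub>v m"
  have r: "r \<in> carrier_vec d" using A m y by (auto simp: r_def)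
  note mz = add_carrier_vec[OF m argmin_carrier[OF r]]
  note gH = pos_def_gauss[OF pos_def_H mz]
  have dM: "0 < Determinant.det M" using pos_def_gauss[OF pos_def_M zero_carrier_vec] by simp
  have dP: "0 < Determinant.det P" using pos_def_gauss[OF P zero_carrier_vec] by simp
  define c where "c = exp (- quad_form M r / 2) * (sqrt (w ^ d / (2 * pi) ^ d) * sqrt (Determinant.det P / (2 * pi) ^ s))"
  have "gauss_density (w \<cdot>\<^sub>m 1\<^sub>m d) (A *\<^sub>v b) y * gauss_density P m b
     = c * exp (- quad_form H (b - (m + argmin r)) / 2)" if b: "b \<in> carrier_vec s" for b
  proof -
    have bm: "b - m \<in> carrier_vec s" using b m by auto
    have "A *\<^sub>v (b - m) = A *\<^sub>v b - A *\<^sub>v m"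
      by (rule mult_minus_distrib_mat_vec[OF A b m])
    then have e1: "y - A *\<^sub>v b = r - A *\<^sub>v (b - m)"
      unfolding r_def using A b m y by (intro eq_vecI) auto
    have e2: "b - (m + argmin r) = b - m - argmin r"
      using b m argmin_carrier[OF r] by (intro eq_vecI) auto
    have "quad_form (w \<cdot>\<^sub>m 1\<^sub>m d) (y - A *\<^sub>v b) = w * scalar_prod (r - A *\<^sub>v (b - m)) (r - A *\<^sub>v (b - m))"
      unfolding e1 using A r bm by (subst smult_mult_mat_vec[of _ d d]) auto
    then have "exp (- quad_form (w \<cdot>\<^sub>m 1\<^sub>m d) (y - A *\<^sub>v b) / 2) * exp (- quad_form P (b - m) / 2)
      = exp (- quad_form M r / 2) * exp (- quad_form H (b - (m + argmin r)) / 2)"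
      unfolding e2 using complete_square[OF r bm] by (simp add: field_simps flip: exp_add)
    then show ?thesis
      using A m by (simp add: gauss_density_def c_def)
  qed
  then have "(\<integral>\<^sup>+b. ennreal (gauss_density (w \<cdot>\<^sub>m 1\<^sub>m d) (A *\<^sub>v b) y * gauss_density P m b) \<partial>lborel_vec s)
    = (\<integral>\<^sup>+b. ennreal c * ennreal (exp (- quad_form H (b - (m + argmin r)) / 2)) \<partial>lborel_vec s)"
    using w dP by (intro nn_integral_cong) (simp add: c_def flip: ennreal_mult')
  also have "\<dots> = ennreal c * ennreal (sqrt ((2 * pi) ^ s / Determinant.det H))"
    using gH measurable_quad_form_shift[OF H_carrier mz] by (subst nn_integral_cmult) auto
  also have "\<dots> = ennreal (c * sqrt ((2 * pi) ^ s / Determinant.det H))"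
    using w dP by (intro ennreal_mult'[symmetric]) (simp add: c_def)
  also have "c * sqrt ((2 * pi) ^ s / Determinant.det H) = gauss_density M (A *\<^sub>v m) y"
  proof -
    have "w ^ d / (2 * pi) ^ d * (Determinant.det P / (2 * pi) ^ s) * ((2 * pi) ^ s / Determinant.det H)
        = (w ^ d * Determinant.det P) / Determinant.det H / (2 * pi) ^ d"
      by simp
    also have "\<dots> = Determinant.det M / (2 * pi) ^ d"
      unfolding det_P_eq using gH by simp
    finally show ?thesis
      using A by (simp add: c_def gauss_density_def r_def flip: real_sqrt_mult)
  qed
  finally show ?thesis .
qed

end

section \<open>Submatrices and finite mixtures\<close>

lemma sub_cols_carrier:
  assumes "X \<in> carrier_mat n p" "S \<subseteq> {..<p}"
  shows "sub_cols X S \<in> carrier_mat n (card S)"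
proof -
  have "{j. j < p \<and> j \<in> S} = S" using assms(2) by auto
  then show ?thesis
    using assms(1) by (intro carrier_matI) (auto simp: sub_cols_def dim_submatrix)
qed

text \<open>The map sends an element to its rank in \<open>S\<close>, with inverse
  \<open>pick S\<close>. The rank stays below \<open>card S\<close> because \<open>j\<close> does
  not count itself.\<close>

lemma bij_betw_card_less:
  assumes "finite (S :: nat set)"
  shows "bij_betw (\<lambda>j. card {i\<in>S. i < j}) S {..<card S}"
proof -
  have inj: "inj_on (\<lambda>j. card {i\<in>S. i < j}) S"
    by (rule inj_on_inverseI[where g = "pick S"]) (rule pick_card_in_set)
  moreover have "card {i\<in>S. i < j} < card S" if "j \<in> S" for j
    using assms that by (intro psubset_card_mono) auto
  then have "(\<lambda>j. card {i\<in>S. i < j}) ` S \<subseteq> {..<card S}" by auto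
  then have "(\<lambda>j. card {i\<in>S. i < j}) ` S = {..<card S}"
    by (intro card_subset_eq) (simp_all add: card_image[OF inj])
  ultimately show ?thesis by (simp add: bij_betw_def)
qed

text \<open>Coordinates outside \<open>S\<close> contribute nothing, and ranking the elements of
  \<open>S\<close> enumerates the columns of the submatrix. This moves integrals over coefficients
  in dimension \<open>p\<close> to dimension \<open>card S\<close>.\<close>

lemma mult_embed_config:
  assumes X: "X \<in> carrier_mat n p" and S: "S \<subseteq> {..<p}" and b: "b \<in> carrier_vec (card S)"
  shows "X *\<^sub>v embed_config p S b = sub_cols X S *\<^sub>v b"
proof (rule eq_vecI)
  note B = sub_cols_carrier[OF X S]
  have fin: "finite S" using S finite_subset by blast
  show "dim_vec (X *\<^sub>v embed_config p S b) = dim_vec (sub_cols X S *\<^sub>v b)"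
    using X B by simp
  fix i assume "i < dim_vec (sub_cols X S *\<^sub>v b)"
  then have i: "i < n" using B by simp
  have "vec_index (X *\<^sub>v embed_config p S b) i
      = (\<Sum>j<p. X $$ (i,j) * (if j \<in> S then vec_index b (card {i\<in>S. i < j}) else 0))"
    using X i by (auto simp: scalar_prod_def embed_config_def atLeast0LessThan intro!: sum.cong)
  also have "\<dots> = (\<Sum>j\<in>S. X $$ (i,j) * vec_index b (card {i\<in>S. i < j}))"
    using S by (intro sum.mono_neutral_cong_right) auto
  also have "\<dots> = (\<Sum>j\<in>S. sub_cols X S $$ (i, card {i\<in>S. i < j}) * vec_index b (card {i\<in>S. i < j}))"
  proof (rule sum.cong)
    fix j assume "j \<in> S"
    then show "X $$ (i,j) * vec_index b (card {i\<in>S. i < j})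
      = sub_cols X S $$ (i, card {i\<in>S. i < j}) * vec_index b (card {i\<in>S. i < j})"
      using submatrix_index_card[of i X j UNIV S] i X S by (auto simp: sub_cols_def)
  qed simp
  also have "\<dots> = (\<Sum>l<card S. sub_cols X S $$ (i,l) * vec_index b l)"
    by (rule sum.reindex_bij_betw[OF bij_betw_card_less[OF fin]])
  also have "\<dots> = vec_index (sub_cols X S *\<^sub>v b) i"
    using B b i by (auto simp: scalar_prod_def atLeast0LessThan intro!: sum.cong)
  finally show "vec_index (X *\<^sub>v embed_config p S b) i = vec_index (sub_cols X S *\<^sub>v b) i" .
qed

lemma embed_config_carrier [simp]: "embed_config p S b \<in> carrier_vec p"
  by (simp add: embed_config_def)

lemma measurable_embed_config:
  assumes "S \<subseteq> {..<p}"
  shows "embed_config p S \<in> measurable (lborel_vec (card S)) (lborel_vec p)"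
proof (rule measurable_lborel_vecI)
  fix i assume i: "i < p"
  have fin: "finite S" using assms finite_subset by blast
  show "(\<lambda>b. vec_index (embed_config p S b) i) \<in> borel_measurable (lborel_vec (card S))"
  proof (cases "i \<in> S")
    case True
    then have "card {j\<in>S. j < i} < card S"
      using bij_betw_card_less[OF fin] by (auto simp: bij_betw_def)
    then show ?thesis using True i by (simp add: embed_config_def measurable_vec_index)
  qed (use i in \<open>simp add: embed_config_def\<close>)
qed simp

section \<open>Integrals against finite mixtures of measures\<close>

lemma sets_slab [simp]: "sets (slab \<gamma> \<sigma> X y S) = sets (lborel_vec (dim_col X))"
  by (simp add: slab_def)

lemma finite_configs: "finite (configs X)"
  by (rule finite_subset[of _ "Pow {..<dim_col X}"]) (auto simp: configs_def)

text \<open>\<open>measure_of\<close> takes the values of a set function only if that function is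
  countably additive; here this amounts to exchanging a finite sum with a series.\<close>

lemma emeasure_finite_mixture:
  fixes M :: "'a measure" and N :: "'i \<Rightarrow> 'a measure" and u :: "'i \<Rightarrow> ennreal"
  assumes sets: "\<And>i. i \<in> I \<Longrightarrow> sets (N i) = sets M"
    and A: "A \<in> sets M"
  shows "emeasure (measure_of (space M) (sets M) (\<lambda>A. \<Sum>i\<in>I. u i * emeasure (N i) A)) A
    = (\<Sum>i\<in>I. u i * emeasure (N i) A)"
proof (rule emeasure_measure_of_sigma[OF sets.sigma_algebra_axioms _ _ A])
  show "positive (sets M) (\<lambda>A. \<Sum>i\<in>I. u i * emeasure (N i) A)"
    by (simp add: positive_def)
  show "countably_additive (sets M) (\<lambda>A. \<Sum>i\<in>I. u i * emeasure (N i) A)"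
  proof (rule countably_additiveI)
    fix F :: "nat \<Rightarrow> 'a set"
    assume F: "range F \<subseteq> sets M" "disjoint_family F"
    have "(\<Sum>k. \<Sum>i\<in>I. u i * emeasure (N i) (F k)) = (\<Sum>i\<in>I. \<Sum>k. u i * emeasure (N i) (F k))"
      by (rule suminf_sum) (rule summableI)
    also have "\<dots> = (\<Sum>i\<in>I. u i * emeasure (N i) (\<Union> (range F)))"
      using F sets by (intro sum.cong) (auto simp: suminf_emeasure)
    finally show "(\<Sum>k. \<Sum>i\<in>I. u i * emeasure (N i) (F k)) = (\<Sum>i\<in>I. u i * emeasure (N i) (\<Union> (range F)))" .
  qed
qed

text \<open>The mixture is known only through its values on sets, so the integral is computed by
  induction on the construction of the measurable function.\<close>

lemma nn_integral_finite_mixture: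
  fixes M :: "'a measure" and N :: "'i \<Rightarrow> 'a measure" and u :: "'i \<Rightarrow> ennreal"
  assumes sets: "\<And>i. i \<in> I \<Longrightarrow> sets (N i) = sets M"
    and f: "f \<in> borel_measurable M"
  shows "nn_integral (measure_of (space M) (sets M) (\<lambda>A. \<Sum>i\<in>I. u i * emeasure (N i) A)) f
    = (\<Sum>i\<in>I. u i * nn_integral (N i) f)"
proof -
  define E where "E = measure_of (space M) (sets M) (\<lambda>A. \<Sum>i\<in>I. u i * emeasure (N i) A)"
  have setsE: "sets E = sets M" unfolding E_def by (rule sets.sets_measure_of_eq)
  have spaceE: "space E = space M" by (rule sets_eq_imp_space_eq[OF setsE])
  have emE: "emeasure E A = (\<Sum>i\<in>I. u i * emeasure (N i) A)" if "A \<in> sets M" for A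
    unfolding E_def by (rule emeasure_finite_mixture[OF sets that])
  have measE: "g \<in> borel_measurable E" if "g \<in> borel_measurable M" for g :: "'a \<Rightarrow> ennreal"
    using that measurable_cong_sets[OF setsE refl] by blast
  have measN: "g \<in> borel_measurable (N i)" if "i \<in> I" "g \<in> borel_measurable M" for i and g :: "'a \<Rightarrow> ennreal"
    using that measurable_cong_sets[OF sets refl] by blast
  have spaceN: "space (N i) = space M" if "i \<in> I" for i
    using sets_eq_imp_space_eq[OF sets[OF that]] .
  from f have "nn_integral E f = (\<Sum>i\<in>I. u i * nn_integral (N i) f)"
  proof (induction rule: borel_measurable_induct)
    case (cong f g)
    have "nn_integral E f = nn_integral E g"
      by (rule nn_integral_cong) (use cong(3) spaceE in auto)
    moreover have "nn_integral (N i) f = nn_integral (N i) g" if "i \<in> I" for i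
      by (rule nn_integral_cong) (use cong(3) spaceN[OF that] in auto)
    ultimately show ?case using cong(4) by simp
  next
    case (set A)
    have "nn_integral E (indicator A) = emeasure E A"
      by (rule nn_integral_indicator) (simp add: setsE set)
    moreover have "nn_integral (N i) (indicator A) = emeasure (N i) A" if "i \<in> I" for i
      by (rule nn_integral_indicator) (simp add: sets[OF that] set)
    ultimately show ?case by (simp add: emE[OF set])
  next
    case (mult v c)
    have "nn_integral E (\<lambda>x. c * v x) = c * nn_integral E v"
      by (rule nn_integral_cmult[OF measE[OF mult(2)]])
    moreover have "nn_integral (N i) (\<lambda>x. c * v x) = c * nn_integral (N i) v" if "i \<in> I" for i
      by (rule nn_integral_cmult[OF measN[OF that mult(2)]])
    ultimately show ?case using mult(4)
      by (simp add: sum_distrib_left mult.left_commute)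
  next
    case (add v w)
    have "nn_integral E (\<lambda>x. w x + v x) = nn_integral E w + nn_integral E v"
      by (rule nn_integral_add[OF measE measE]) fact+
    moreover have "nn_integral (N i) (\<lambda>x. w x + v x) = nn_integral (N i) w + nn_integral (N i) v" if "i \<in> I" for i
      by (rule nn_integral_add[OF measN[OF that] measN[OF that]]) fact+
    ultimately show ?case using add.IH
      by (simp add: sum.distrib distrib_left)
  next
    case (seq U)
    have SUP_eq: "(SUP k. U k) = (\<lambda>x. SUP k. U k x)" by (auto simp: image_comp)
    have "nn_integral E (SUP k. U k) = (SUP k. nn_integral E (U k))"
      unfolding SUP_eq by (rule nn_integral_monotone_convergence_SUP[OF \<open>incseq U\<close> measE[OF seq.hyps(1)]])
    also have "\<dots> = (SUP k. \<Sum>i\<in>I. u i * nn_integral (N i) (U k))"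
      by (simp only: seq.IH)
    \<comment> \<open>The supremum passes through the finite sum because each summand increases with
      \<open>k\<close>.\<close>
    also have "\<dots> = (\<Sum>i\<in>I. SUP k. u i * nn_integral (N i) (U k))"
      by (rule ennreal_SUP_sum)
         (use seq.hyps in \<open>auto intro!: mult_left_mono nn_integral_mono simp: incseq_def le_fun_def\<close>)
    also have "\<dots> = (\<Sum>i\<in>I. u i * nn_integral (N i) (SUP k. U k))"
    proof (rule sum.cong)
      fix i assume "i \<in> I"
      then show "(SUP k. u i * nn_integral (N i) (U k)) = u i * nn_integral (N i) (SUP k. U k)"
        unfolding SUP_eq SUP_mult_left_ennreal[symmetric]
        by (subst nn_integral_monotone_convergence_SUP[OF \<open>incseq U\<close> measN[OF _ seq.hyps(1)]]) auto
    qed simp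
    finally show ?case .
  qed
  then show ?thesis unfolding E_def .
qed

lemma sets_emp_prior [simp]: "sets (emp_prior a c \<gamma> \<sigma> X y) = sets (lborel_vec (dim_col X))"
  unfolding emp_prior_def by (rule sets.sets_measure_of_eq)

lemma nn_integral_emp_prior:
  assumes "f \<in> borel_measurable (lborel_vec (dim_col X))"
  shows "nn_integral (emp_prior a c \<gamma> \<sigma> X y) f
    = (\<Sum>S\<in>configs X. ennreal (config_prior a c X S) * nn_integral (slab \<gamma> \<sigma> X y S) f)"
  unfolding emp_prior_def by (rule nn_integral_finite_mixture) (use assms in auto)

section \<open>The posterior and the predictive distribution\<close>

lemma measurable_mvn_density:
  assumes S: "S \<in> carrier_mat k k" and Q: "Q \<in> carrier_mat k k" and SQ: "S * Q = 1\<^sub>m k"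
    and f: "f \<in> measurable M (lborel_vec k)" and g: "g \<in> measurable M (lborel_vec k)"
  shows "(\<lambda>x. mvn_density (f x) S (g x)) \<in> borel_measurable M"
proof -
  have "mvn_density (f x) S (g x) = gauss_density Q (f x) (g x)" if "x \<in> space M" for x
    using measurable_space[OF f that] by (intro mvn_density_eq_gauss[OF S Q SQ]) simp
  then show ?thesis
    using measurable_gauss_density[OF Q f g] by (simp cong: measurable_cong)
qed

lemma quad_form_smult:
  assumes "Q \<in> carrier_mat k k" "x \<in> carrier_vec k"
  shows "quad_form (c \<cdot>\<^sub>m Q) x = c * quad_form Q x"
  using assms by (simp add: smult_mult_mat_vec[OF assms])

lemma isotropic_mult:
  fixes u :: real
  assumes "u \<noteq> 0"
  shows "(u \<cdot>\<^sub>m 1\<^sub>m k) * ((1 / u) \<cdot>\<^sub>m 1\<^sub>m k) = 1\<^sub>m k"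
  using assms by (simp add: mult_smult_distrib[of _ k k _ k] mult_smult_assoc_mat[of _ k k _ k])
    (intro eq_matI, auto)

text \<open>One sample size and one data vector \<open>y\<close> are fixed; the theorem enters the
  locale anew for each outcome. The bound on \<open>p\<close> keeps the base
  \<open>c * p powr a\<close> of the size prior positive.\<close>

locale empirical_bayes =
  fixes n p d :: nat and X Xt :: "real mat" and y :: "real Matrix.vec" and a c \<gamma> \<alpha> \<sigma> :: real
  assumes c: "c > 0" and \<gamma>: "\<gamma> > 0" and \<alpha>: "\<alpha> > 0" and \<sigma>: "\<sigma> > 0" and p: "p \<ge> 1"
    and X: "X \<in> carrier_mat n p" and Xt: "Xt \<in> carrier_mat d p" and y: "y \<in> carrier_vec n"
    and gram_invertible: "\<And>S. S \<in> configs X \<Longrightarrow> invertible_mat (gram X S)"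
begin

abbreviation "post_prec S \<equiv> ((\<alpha> + \<gamma>) / \<sigma>\<^sup>2) \<cdot>\<^sub>m gram X S"
abbreviation "pred_cov S \<equiv> \<sigma>\<^sup>2 \<cdot>\<^sub>m (1\<^sub>m d + pred_V \<gamma> \<alpha> X Xt S)"
text \<open>The normalizing factor of the likelihood raised to \<open>\<alpha>\<close>. It is common
  to all configurations and will cancel in the posterior.\<close>

definition likelihood_const :: real where
  "likelihood_const = sqrt (Determinant.det ((1 / \<sigma>\<^sup>2) \<cdot>\<^sub>m 1\<^sub>m n) / (2 * pi) ^ n) powr \<alpha>"

lemma config_subset: "S \<in> configs X \<Longrightarrow> S \<subseteq> {..<p}"
  using X by (auto simp: configs_def)

lemma design_carrier: "S \<in> configs X \<Longrightarrow> sub_cols X S \<in> carrier_mat n (card S)"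
  by (rule sub_cols_carrier[OF X config_subset])

lemma pos_def_gram_config: "S \<in> configs X \<Longrightarrow> pos_def (card S) (gram X S)"
  unfolding gram_def using gram_invertible design_carrier by (intro pos_def_gram) (auto simp: gram_def)

lemma lse_carrier: "S \<in> configs X \<Longrightarrow> lse X y S \<in> carrier_vec (card S)"
  using design_carrier[of S] pos_def_mat_inv(1)[OF pos_def_gram_config[of S]] y by (auto simp: lse_def)

lemma pos_def_post_prec: "S \<in> configs X \<Longrightarrow> pos_def (card S) (post_prec S)"
  using \<alpha> \<gamma> \<sigma> by (intro pos_def_smult pos_def_gram_config) auto

section \<open>Least squares geometry and the conjugate update within one configuration\<close>

lemma residual_orthogonal:
  assumes S: "S \<in> configs X"
  shows "transpose_mat (sub_cols X S) *\<^sub>v (y - sub_cols X S *\<^sub>v lse X y S) = 0\<^sub>v (card S)"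
proof -
  let ?B = "sub_cols X S"
  note B = design_carrier[OF S] and m = lse_carrier[OF S]
  note Gi = pos_def_mat_inv[OF pos_def_gram_config[OF S]]
  note G = pos_defD(1)[OF pos_def_gram_config[OF S]]
  have v: "transpose_mat ?B *\<^sub>v y \<in> carrier_vec (card S)" using B y by auto
  have "transpose_mat ?B *\<^sub>v (?B *\<^sub>v lse X y S) = gram X S *\<^sub>v lse X y S"
    unfolding gram_def by (rule assoc_mult_mat_vec[symmetric]) (use B m in auto)
  also have "\<dots> = (gram X S * mat_inv (gram X S)) *\<^sub>v (transpose_mat ?B *\<^sub>v y)"
    unfolding lse_def by (rule assoc_mult_mat_vec[symmetric, OF G Gi(1) v])
  also have "\<dots> = transpose_mat ?B *\<^sub>v y"
    unfolding Gi(2) using v by simp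
  finally have eq: "transpose_mat ?B *\<^sub>v (?B *\<^sub>v lse X y S) = transpose_mat ?B *\<^sub>v y" .
  have "transpose_mat ?B *\<^sub>v (y - ?B *\<^sub>v lse X y S)
      = transpose_mat ?B *\<^sub>v y - transpose_mat ?B *\<^sub>v (?B *\<^sub>v lse X y S)"
    by (rule mult_minus_distrib_mat_vec) (use B m y in auto)
  then show ?thesis unfolding eq using v by simp
qed

text \<open>The residual \<open>e\<close> is orthogonal to the columns, hence to \<open>h\<close>.
  The dependence on \<open>b\<close> is thereby a multiple of the quadratic form that the slab has
  too, with the same centre.\<close>

lemma residual_pythagoras:
  assumes S: "S \<in> configs X" and b: "b \<in> carrier_vec (card S)"
  shows "scalar_prod (y - sub_cols X S *\<^sub>v b) (y - sub_cols X S *\<^sub>v b)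
    = scalar_prod (y - sub_cols X S *\<^sub>v lse X y S) (y - sub_cols X S *\<^sub>v lse X y S)
      + quad_form (gram X S) (b - lse X y S)"
proof -
  let ?B = "sub_cols X S"
  define e where "e = y - ?B *\<^sub>v lse X y S"
  define h where "h = ?B *\<^sub>v (b - lse X y S)"
  note B = design_carrier[OF S] and m = lse_carrier[OF S]
  have e: "e \<in> carrier_vec n" and h: "h \<in> carrier_vec n" and bm: "b - lse X y S \<in> carrier_vec (card S)"
    using B m y b by (auto simp: e_def h_def)
  have "h = ?B *\<^sub>v b - ?B *\<^sub>v lse X y S"
    unfolding h_def by (rule mult_minus_distrib_mat_vec[OF B b m])
  then have "y - ?B *\<^sub>v b = e - h"
    unfolding e_def using B b m y by (intro eq_vecI) auto
  moreover have "scalar_prod e h = 0"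
    unfolding h_def scalar_prod_mult_mat_vec[OF B e bm]
    using residual_orthogonal[OF S] bm by (simp add: e_def)
  moreover have "gram X S *\<^sub>v (b - lse X y S) = transpose_mat ?B *\<^sub>v h"
    unfolding gram_def h_def by (rule assoc_mult_mat_vec) (use B bm in auto)
  then have "quad_form (gram X S) (b - lse X y S) = scalar_prod h h"
    using scalar_prod_mult_mat_vec[of "transpose_mat ?B" "card S" n "b - lse X y S" h] B bm h
    by (simp add: h_def)
  ultimately show ?thesis
    using e h by (simp add: minus_scalar_prod_distrib[of _ n] scalar_prod_minus_distrib[of _ n]
        comm_scalar_prod[of h n e] flip: e_def)
qed

lemma likelihood_eq_gauss:
  assumes "\<beta> \<in> carrier_vec p"
  shows "likelihood \<sigma> X y \<beta> = gauss_density ((1 / \<sigma>\<^sup>2) \<cdot>\<^sub>m 1\<^sub>m n) (X *\<^sub>v \<beta>) y"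
proof -
  have "dim_row X = n" using X by simp
  then show ?thesis
    unfolding likelihood_def using X assms \<sigma>
    by (intro mvn_density_eq_gauss[where k = n]) (auto intro!: isotropic_mult)
qed

lemma likelihood_const_pos: "0 < likelihood_const"
  using \<sigma> by (simp add: likelihood_const_def)

lemma likelihood_powr:
  assumes \<beta>: "\<beta> \<in> carrier_vec p"
  shows "likelihood \<sigma> X y \<beta> powr \<alpha>
    = likelihood_const * exp (- \<alpha> / (2 * \<sigma>\<^sup>2) * scalar_prod (y - X *\<^sub>v \<beta>) (y - X *\<^sub>v \<beta>))"
proof -
  have v: "y - X *\<^sub>v \<beta> \<in> carrier_vec n" "dim_vec (X *\<^sub>v \<beta>) = n" using X y \<beta> by auto
  have "likelihood \<sigma> X y \<beta> = exp (- (scalar_prod (y - X *\<^sub>v \<beta>) (y - X *\<^sub>v \<beta>) / \<sigma>\<^sup>2) / 2)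
      * sqrt (Determinant.det ((1 / \<sigma>\<^sup>2) \<cdot>\<^sub>m 1\<^sub>m n) / (2 * pi) ^ n)"
    unfolding likelihood_eq_gauss[OF \<beta>] gauss_density_def v(2)
    using v(1) by (subst quad_form_smult[of _ n]) auto
  then show ?thesis
    using \<sigma> by (simp add: likelihood_const_def powr_mult exp_powr_real field_simps)
qed

lemma slab_prec:
  assumes S: "S \<in> configs X"
  shows "((\<sigma>\<^sup>2 / \<gamma>) \<cdot>\<^sub>m mat_inv (gram X S)) * ((\<gamma> / \<sigma>\<^sup>2) \<cdot>\<^sub>m gram X S) = 1\<^sub>m (card S)"
  using pos_def_mat_inv[OF pos_def_gram_config[OF S]] pos_defD(1)[OF pos_def_gram_config[OF S]] \<gamma> \<sigma>
  by (simp add: mult_smult_distrib[of _ "card S" "card S" _ "card S"]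
      mult_smult_assoc_mat[of _ "card S" "card S" _ "card S"])
    (intro eq_matI, auto)

text \<open>The factor by which the data change the prior mass of a configuration, up to
  \<open>likelihood_const\<close>. The power of \<open>\<gamma> / (\<alpha> + \<gamma>)\<close> is
  the square root of the ratio of the determinants of the precisions before and after the
  update.\<close>

definition evidence :: "nat set \<Rightarrow> real" where
  "evidence S = (\<gamma> / (\<alpha> + \<gamma>)) powr (real (card S) / 2)
     * exp (- \<alpha> / (2 * \<sigma>\<^sup>2) * scalar_prod (y - sub_cols X S *\<^sub>v lse X y S) (y - sub_cols X S *\<^sub>v lse X y S))"

lemma evidence_pos: "0 < evidence S"
  using \<alpha> \<gamma> by (simp add: evidence_def)

lemma config_weight_eq: "config_weight a c \<gamma> \<alpha> \<sigma> X y S = config_prior a c X S * evidence S"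
  by (simp add: config_weight_def evidence_def Let_def)

text \<open>Both exponents are multiples of the same \<open>q\<close>, so their coefficients
  \<open>\<gamma>\<close> and \<open>\<alpha>\<close> add and the mean stays at the least squares
  estimator; only the residual sum of squares factors out.\<close>

lemma slab_update:
  assumes S: "S \<in> configs X" and b: "b \<in> carrier_vec (card S)"
  shows "mvn_density (lse X y S) ((\<sigma>\<^sup>2 / \<gamma>) \<cdot>\<^sub>m mat_inv (gram X S)) b
      * likelihood \<sigma> X y (embed_config p S b) powr \<alpha>
    = likelihood_const * evidence S * gauss_density (post_prec S) (lse X y S) b"
proof -
  let ?s = "card S" and ?m = "lse X y S" and ?G = "gram X S"
  note G = pos_defD(1)[OF pos_def_gram_config[OF S]] and m = lse_carrier[OF S]
  note Gi = pos_def_mat_inv[OF pos_def_gram_config[OF S]]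
  have dG: "0 < Determinant.det ?G" using pos_def_gauss[OF pos_def_gram_config[OF S] zero_carrier_vec] by simp
  define q where "q = quad_form ?G (b - ?m)"
  define rss where "rss = scalar_prod (y - sub_cols X S *\<^sub>v ?m) (y - sub_cols X S *\<^sub>v ?m)"
  define D where "D = Determinant.det ?G / (2 * pi) ^ ?s"
  have form: "quad_form (u \<cdot>\<^sub>m ?G) (b - ?m) = u * q" for u
    unfolding q_def by (rule quad_form_smult[OF G]) (use b m in auto)
  \<comment> \<open>The precisions before and after the update are multiples of one Gram matrix, so
    \<open>D\<close> is common to both and only powers of the scalars have to be compared.\<close>
  have gauss: "gauss_density (u \<cdot>\<^sub>m ?G) ?m b = exp (- (u * q) / 2) * (sqrt (u ^ ?s) * sqrt D)" for u
    unfolding gauss_density_def form using m G by (simp add: D_def flip: real_sqrt_mult)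
  have slab: "mvn_density ?m ((\<sigma>\<^sup>2 / \<gamma>) \<cdot>\<^sub>m mat_inv ?G) b = gauss_density ((\<gamma> / \<sigma>\<^sup>2) \<cdot>\<^sub>m ?G) ?m b"
    by (rule mvn_density_eq_gauss[OF _ _ slab_prec[OF S] m]) (use Gi G in auto)
  have "likelihood \<sigma> X y (embed_config p S b) powr \<alpha>
      = likelihood_const * exp (- \<alpha> / (2 * \<sigma>\<^sup>2) * (rss + q))"
    unfolding likelihood_powr[OF embed_config_carrier] mult_embed_config[OF X config_subset[OF S] b]
      residual_pythagoras[OF S b] rss_def q_def ..
  then have lik: "likelihood \<sigma> X y (embed_config p S b) powr \<alpha>
      = likelihood_const * (exp (- \<alpha> / (2 * \<sigma>\<^sup>2) * rss) * exp (- \<alpha> / (2 * \<sigma>\<^sup>2) * q))"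
    by (simp add: distrib_left flip: exp_add)
  have exps: "exp (- (\<gamma> / \<sigma>\<^sup>2 * q) / 2) * exp (- \<alpha> / (2 * \<sigma>\<^sup>2) * q) = exp (- ((\<alpha> + \<gamma>) / \<sigma>\<^sup>2 * q) / 2)"
    using \<sigma> by (simp add: field_simps flip: exp_add)
  have "sqrt ((\<gamma> / \<sigma>\<^sup>2) ^ ?s) = sqrt ((\<gamma> / (\<alpha> + \<gamma>)) ^ ?s) * sqrt (((\<alpha> + \<gamma>) / \<sigma>\<^sup>2) ^ ?s)"
    using \<alpha> \<gamma> by (simp flip: real_sqrt_mult power_mult_distrib)
  also have "sqrt ((\<gamma> / (\<alpha> + \<gamma>)) ^ ?s) = (\<gamma> / (\<alpha> + \<gamma>)) powr (real ?s / 2)"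
    using \<alpha> \<gamma> by (simp add: powr_half_sqrt[symmetric] powr_powr flip: powr_realpow)
  finally have roots: "sqrt ((\<gamma> / \<sigma>\<^sup>2) ^ ?s)
      = (\<gamma> / (\<alpha> + \<gamma>)) powr (real ?s / 2) * sqrt (((\<alpha> + \<gamma>) / \<sigma>\<^sup>2) ^ ?s)" .
  show ?thesis
    unfolding slab gauss lik roots evidence_def exps[symmetric] rss_def[symmetric] by (simp only: mult_ac)
qed

lemma measurable_likelihood_powr:
  "(\<lambda>\<beta>. likelihood \<sigma> X y \<beta> powr \<alpha>) \<in> borel_measurable (lborel_vec p)"
proof -
  have "likelihood \<sigma> X y \<in> borel_measurable (lborel_vec p)"
    unfolding likelihood_def using X y \<sigma>
    by (intro measurable_mvn_density[where k = n and Q = "(1 / \<sigma>\<^sup>2) \<cdot>\<^sub>m 1\<^sub>m n"])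
       (auto intro!: isotropic_mult measurable_mult_mat_vec)
  then show ?thesis by simp
qed

text \<open>An arbitrary \<open>h\<close> is carried along so that one computation serves both the
  normalizing constant, with \<open>h = 1\<close>, and integrals against the posterior.\<close>

lemma nn_integral_slab:
  assumes S: "S \<in> configs X" and h: "h \<in> borel_measurable (lborel_vec p)"
  shows "(\<integral>\<^sup>+\<beta>. ennreal (likelihood \<sigma> X y \<beta> powr \<alpha>) * h \<beta> \<partial>slab \<gamma> \<sigma> X y S)
    = ennreal likelihood_const * (ennreal (evidence S) *
        (\<integral>\<^sup>+b. ennreal (gauss_density (post_prec S) (lse X y S) b) * h (embed_config p S b) \<partial>lborel_vec (card S)))"
proof -
  let ?C = "(\<sigma>\<^sup>2 / \<gamma>) \<cdot>\<^sub>m mat_inv (gram X S)"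
  let ?g = "\<lambda>\<beta>. ennreal (likelihood \<sigma> X y \<beta> powr \<alpha>) * h \<beta>"
  note m = lse_carrier[OF S] and G = pos_defD(1)[OF pos_def_gram_config[OF S]]
  note Gi = pos_def_mat_inv(1)[OF pos_def_gram_config[OF S]]
  have emb: "embed_config p S \<in> measurable (mvn (lse X y S) ?C) (lborel_vec p)"
    using measurable_embed_config[OF config_subset[OF S]] m by (simp cong: measurable_cong_sets)
  have g: "?g \<in> borel_measurable (lborel_vec p)"
    using measurable_likelihood_powr h by simp
  have gemb: "(\<lambda>b. ?g (embed_config p S b)) \<in> borel_measurable (lborel_vec (card S))"
    by (rule measurable_compose[OF measurable_embed_config[OF config_subset[OF S]] g])
  have hemb: "(\<lambda>b. h (embed_config p S b)) \<in> borel_measurable (lborel_vec (card S))"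
    by (rule measurable_compose[OF measurable_embed_config[OF config_subset[OF S]] h])
  have gd: "(\<lambda>b. gauss_density (post_prec S) (lse X y S) b) \<in> borel_measurable (lborel_vec (card S))"
    by (rule measurable_gauss_density) (use m G in auto)
  have "(\<integral>\<^sup>+\<beta>. ?g \<beta> \<partial>slab \<gamma> \<sigma> X y S) = (\<integral>\<^sup>+b. ?g (embed_config p S b) \<partial>mvn (lse X y S) ?C)"
    unfolding slab_def using X emb g by (subst nn_integral_distr) auto
  also have "\<dots> = (\<integral>\<^sup>+b. ennreal (mvn_density (lse X y S) ?C b) * ?g (embed_config p S b) \<partial>lborel_vec (card S))"
  proof -
    have "mvn_density (lse X y S) ?C \<in> borel_measurable (lborel_vec (card S))"
      by (rule measurable_mvn_density[OF _ _ slab_prec[OF S]]) (use m G Gi in auto)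
    then show ?thesis
      unfolding mvn_def using m gemb by (subst nn_integral_density) auto
  qed
  also have "\<dots> = (\<integral>\<^sup>+b. ennreal (likelihood_const * evidence S) *
      (ennreal (gauss_density (post_prec S) (lse X y S) b) * h (embed_config p S b)) \<partial>lborel_vec (card S))"
  proof (rule nn_integral_cong)
    fix b assume "b \<in> space (lborel_vec (card S))"
    then have b: "b \<in> carrier_vec (card S)" by simp
    have "ennreal (mvn_density (lse X y S) ?C b) * ?g (embed_config p S b)
      = ennreal (mvn_density (lse X y S) ?C b * likelihood \<sigma> X y (embed_config p S b) powr \<alpha>) * h (embed_config p S b)"
      by (simp add: ennreal_mult'' mult.assoc)
    also have "\<dots> = ennreal (likelihood_const * evidence S) *
      (ennreal (gauss_density (post_prec S) (lse X y S) b) * h (embed_config p S b))"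
      unfolding slab_update[OF S b] using likelihood_const_pos evidence_pos[of S]
      by (subst ennreal_mult') (simp_all add: mult.assoc)
    finally show "ennreal (mvn_density (lse X y S) ?C b) * ?g (embed_config p S b) = \<dots>" .
  qed
  also have "\<dots> = ennreal (likelihood_const * evidence S) *
      (\<integral>\<^sup>+b. ennreal (gauss_density (post_prec S) (lse X y S) b) * h (embed_config p S b) \<partial>lborel_vec (card S))"
    using gd hemb by (subst nn_integral_cmult) auto
  also have "ennreal (likelihood_const * evidence S) = ennreal likelihood_const * ennreal (evidence S)"
    using likelihood_const_pos by (intro ennreal_mult') simp
  finally show ?thesis by (simp only: mult.assoc)
qed


section \<open>Posterior weights and integrals against the posterior\<close>

lemma config_prior_nonneg: "0 \<le> config_prior a c X S"
  using c by (auto simp: config_prior_def size_prior_def intro!: mult_nonneg_nonneg sum_nonneg)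

lemma empty_in_configs: "{} \<in> configs X"
  by (simp add: configs_def)

text \<open>The empty configuration is always admissible, so its positive mass keeps the total
  weight, a later denominator, away from 0.\<close>

lemma config_prior_empty_pos: "0 < config_prior a c X {}"
proof -
  have "0 < c * real (dim_col X) powr a" using c p X by simp
  then have "0 < (\<Sum>t\<le>mat_rank X. 1 / (c * real (dim_col X) powr a) ^ t)"
    by (intro sum_pos) auto
  then show ?thesis using empty_in_configs by (simp add: config_prior_def size_prior_def)
qed

abbreviation "total_weight \<equiv> (\<Sum>T\<in>configs X. config_weight a c \<gamma> \<alpha> \<sigma> X y T)"
abbreviation "post \<equiv> config_posterior a c \<gamma> \<alpha> \<sigma> X y"

lemma config_weight_nonneg: "0 \<le> config_weight a c \<gamma> \<alpha> \<sigma> X y S"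
  using config_prior_nonneg[of S] evidence_pos[of S] by (simp add: config_weight_eq)

lemma total_weight_pos: "0 < total_weight"
  using config_prior_empty_pos evidence_pos[of "{}"] config_weight_nonneg
  by (intro sum_pos2[OF finite_configs empty_in_configs]) (auto simp: config_weight_eq)

lemma post_nonneg: "0 \<le> post S"
  using config_weight_nonneg[of S] total_weight_pos by (simp add: config_posterior_def)

lemma sum_post: "(\<Sum>S\<in>configs X. post S) = 1"
  using total_weight_pos by (simp add: config_posterior_def flip: sum_divide_distrib)

lemma nn_integral_tempered_prior:
  assumes h: "h \<in> borel_measurable (lborel_vec p)"
  shows "(\<integral>\<^sup>+\<beta>. ennreal (likelihood \<sigma> X y \<beta> powr \<alpha>) * h \<beta> \<partial>emp_prior a c \<gamma> \<sigma> X y)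
    = ennreal likelihood_const * (\<Sum>S\<in>configs X. ennreal (config_weight a c \<gamma> \<alpha> \<sigma> X y S) *
        (\<integral>\<^sup>+b. ennreal (gauss_density (post_prec S) (lse X y S) b) * h (embed_config p S b) \<partial>lborel_vec (card S)))"
proof -
  have "dim_col X = p" using X by simp
  then have "(\<lambda>\<beta>. ennreal (likelihood \<sigma> X y \<beta> powr \<alpha>) * h \<beta>) \<in> borel_measurable (lborel_vec (dim_col X))"
    using measurable_likelihood_powr h by simp
  then have "(\<integral>\<^sup>+\<beta>. ennreal (likelihood \<sigma> X y \<beta> powr \<alpha>) * h \<beta> \<partial>emp_prior a c \<gamma> \<sigma> X y)
      = (\<Sum>S\<in>configs X. ennreal (config_prior a c X S) *
          (\<integral>\<^sup>+\<beta>. ennreal (likelihood \<sigma> X y \<beta> powr \<alpha>) * h \<beta> \<partial>slab \<gamma> \<sigma> X y S))"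
    by (rule nn_integral_emp_prior)
  then show ?thesis
    unfolding sum_distrib_left config_weight_eq ennreal_mult'[OF config_prior_nonneg]
    by (simp only: nn_integral_slab[OF _ h] mult.assoc mult.left_commute[of "ennreal likelihood_const"] cong: sum.cong)
qed

text \<open>Each inner Gaussian integral is 1, so the extended integral is a finite positive sum;
  the Bochner integral is thus its true value and not the default 0.\<close>

lemma normalizing_constant:
  "(\<integral>\<beta>. likelihood \<sigma> X y \<beta> powr \<alpha> \<partial>emp_prior a c \<gamma> \<sigma> X y) = likelihood_const * total_weight"
proof -
  have "sets (emp_prior a c \<gamma> \<sigma> X y) = sets (lborel_vec p)" using X by simp
  note cong = measurable_cong_sets[OF this refl]
  have "(\<lambda>\<beta>. likelihood \<sigma> X y \<beta> powr \<alpha>) \<in> borel_measurable (emp_prior a c \<gamma> \<sigma> X y)"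
    using measurable_likelihood_powr unfolding cong .
  then have "(\<integral>\<beta>. likelihood \<sigma> X y \<beta> powr \<alpha> \<partial>emp_prior a c \<gamma> \<sigma> X y)
      = enn2real (\<integral>\<^sup>+\<beta>. ennreal (likelihood \<sigma> X y \<beta> powr \<alpha>) * 1 \<partial>emp_prior a c \<gamma> \<sigma> X y)"
    by (subst integral_eq_nn_integral) auto
  also have "\<dots> = enn2real (ennreal likelihood_const * (\<Sum>S\<in>configs X. ennreal (config_weight a c \<gamma> \<alpha> \<sigma> X y S)))"
    by (subst nn_integral_tempered_prior)
       (simp_all add: nn_integral_gauss_density[OF pos_def_post_prec lse_carrier])
  also have "\<dots> = likelihood_const * total_weight"
    using likelihood_const_pos config_weight_nonneg total_weight_pos
    by (simp add: sum_ennreal enn2real_mult)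
  finally show ?thesis .
qed

text \<open>\<open>likelihood_const\<close> occurs both in the tempered integral and in
  \<open>Z\<close>; after it cancels, the coefficient of each updated slab is its weight divided by
  the total weight.\<close>

lemma nn_integral_posterior:
  assumes h: "h \<in> borel_measurable (lborel_vec p)"
  shows "(\<integral>\<^sup>+\<beta>. h \<beta> \<partial>emp_posterior a c \<gamma> \<alpha> \<sigma> X y)
    = (\<Sum>S\<in>configs X. ennreal (post S) *
        (\<integral>\<^sup>+b. ennreal (gauss_density (post_prec S) (lse X y S) b) * h (embed_config p S b) \<partial>lborel_vec (card S)))"
    (is "_ = (\<Sum>S\<in>_. _ * ?I S)")
proof -
  let ?E = "emp_prior a c \<gamma> \<sigma> X y"
  define Z where "Z = likelihood_const * total_weight"
  have Z: "0 < Z" using likelihood_const_pos total_weight_pos by (simp add: Z_def)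
  have "sets ?E = sets (lborel_vec p)" using X by simp
  note cong = measurable_cong_sets[OF this refl]
  have mL: "(\<lambda>\<beta>. likelihood \<sigma> X y \<beta> powr \<alpha>) \<in> borel_measurable ?E"
    using measurable_likelihood_powr unfolding cong .
  have mh: "h \<in> borel_measurable ?E" using h unfolding cong .
  have "(\<integral>\<^sup>+\<beta>. h \<beta> \<partial>emp_posterior a c \<gamma> \<alpha> \<sigma> X y)
      = (\<integral>\<^sup>+\<beta>. ennreal (likelihood \<sigma> X y \<beta> powr \<alpha> / Z) * h \<beta> \<partial>?E)"
    unfolding emp_posterior_def normalizing_constant Z_def[symmetric]
    using mL mh by (subst nn_integral_density) auto
  also have "\<dots> = (\<integral>\<^sup>+\<beta>. ennreal (1 / Z) * (ennreal (likelihood \<sigma> X y \<beta> powr \<alpha>) * h \<beta>) \<partial>?E)"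
    using Z by (intro nn_integral_cong) (simp add: ennreal_mult'[symmetric] mult.assoc[symmetric])
  also have "\<dots> = ennreal (1 / Z) * (ennreal likelihood_const *
      (\<Sum>S\<in>configs X. ennreal (config_weight a c \<gamma> \<alpha> \<sigma> X y S) * ?I S))"
    using mL mh by (subst nn_integral_cmult) (simp_all add: nn_integral_tempered_prior[OF h])
  also have "\<dots> = (\<Sum>S\<in>configs X. ennreal (1 / Z * likelihood_const * config_weight a c \<gamma> \<alpha> \<sigma> X y S) * ?I S)"
    using Z likelihood_const_pos
    by (simp add: sum_distrib_left ennreal_mult' mult.assoc del: times_divide_eq_left)
  also have "\<dots> = (\<Sum>S\<in>configs X. ennreal (post S) * ?I S)"
  proof -
    have "1 / Z * likelihood_const * config_weight a c \<gamma> \<alpha> \<sigma> X y S = post S" for S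
      using likelihood_const_pos by (simp add: Z_def config_posterior_def)
    then show ?thesis by (simp only:)
  qed
  finally show ?thesis .
qed

section \<open>Predictive normals and the total variation bound\<close>

definition pred_prec :: "nat set \<Rightarrow> real mat" where
  "pred_prec S = linear_gaussian.M d (sub_cols Xt S) (post_prec S) (1 / \<sigma>\<^sup>2)"

lemma new_design_carrier: "S \<in> configs X \<Longrightarrow> sub_cols Xt S \<in> carrier_mat d (card S)"
  by (rule sub_cols_carrier[OF Xt config_subset])

lemma linear_gaussian_config:
  "S \<in> configs X \<Longrightarrow> linear_gaussian d (card S) (sub_cols Xt S) (post_prec S) (1 / \<sigma>\<^sup>2)"
  using new_design_carrier pos_def_post_prec \<sigma> by unfold_locales auto

lemma pos_def_pred_prec: "S \<in> configs X \<Longrightarrow> pos_def d (pred_prec S)"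
  unfolding pred_prec_def by (rule linear_gaussian.pos_def_M[OF linear_gaussian_config])

lemma pred_cov_carrier: "S \<in> configs X \<Longrightarrow> pred_cov S \<in> carrier_mat d d"
  using new_design_carrier[of S] pos_def_mat_inv(1)[OF pos_def_gram_config[of S]] by (auto simp: pred_V_def)

lemma pred_mean_carrier: "S \<in> configs X \<Longrightarrow> pred_mean X Xt y S \<in> carrier_vec d"
  using new_design_carrier[of S] lse_carrier[of S] by (auto simp: pred_mean_def)

text \<open>Since \<open>post_prec S\<close> is inverted by
  \<open>\<sigma>\<^sup>2 / (\<alpha> + \<gamma>)\<close> times the inverse Gram matrix, the
  covariance \<open>(1/w) I + A P^-1 A^T\<close> of the linear Gaussian setting becomes
  \<open>pred_cov S\<close>. The check is made on vectors, as \<open>cov_mult_M\<close>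
  asks.\<close>

lemma pred_cov_mult_prec:
  assumes S: "S \<in> configs X"
  shows "pred_cov S * pred_prec S = 1\<^sub>m d"
  unfolding pred_prec_def
proof (rule linear_gaussian.cov_mult_M[OF linear_gaussian_config[OF S] pred_cov_carrier[OF S]])
  let ?A = "sub_cols Xt S" and ?G = "gram X S"
  note A = new_design_carrier[OF S]
  note G = pos_defD(1)[OF pos_def_gram_config[OF S]]
  note Gi = pos_def_mat_inv[OF pos_def_gram_config[OF S]]
  have inv: "mat_inv (post_prec S) = (\<sigma>\<^sup>2 / (\<alpha> + \<gamma>)) \<cdot>\<^sub>m mat_inv ?G"
    using G Gi \<alpha> \<gamma> \<sigma>
    by (intro mat_inv_eqI[of _ "card S"])
       (simp_all add: mult_smult_distrib[of _ "card S" "card S" _ "card S"]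
          mult_smult_assoc_mat[of _ "card S" "card S" _ "card S"], intro eq_matI, auto)
  fix v :: "real Matrix.vec" assume v: "v \<in> carrier_vec d"
  define u where "u = mat_inv ?G *\<^sub>v (transpose_mat ?A *\<^sub>v v)"
  have u: "u \<in> carrier_vec (card S)" using A Gi v by (auto simp: u_def)
  have Au: "?A *\<^sub>v u \<in> carrier_vec d" using A u by auto
  have AGA: "?A * mat_inv ?G * transpose_mat ?A \<in> carrier_mat d d" using A Gi by auto
  have "(?A * mat_inv ?G * transpose_mat ?A) *\<^sub>v v = ?A *\<^sub>v u"
    using A Gi(1) v by (simp add: u_def assoc_mult_mat_vec[of _ d "card S" _ d]
        assoc_mult_mat_vec[of _ "card S" "card S" _ d])
  then have "pred_V \<gamma> \<alpha> X Xt S *\<^sub>v v = (1 / (\<alpha> + \<gamma>)) \<cdot>\<^sub>v (?A *\<^sub>v u)"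
    unfolding pred_V_def smult_mult_mat_vec[OF AGA v] by simp
  moreover have "(1\<^sub>m d + pred_V \<gamma> \<alpha> X Xt S) *\<^sub>v v = 1\<^sub>m d *\<^sub>v v + pred_V \<gamma> \<alpha> X Xt S *\<^sub>v v"
    by (rule add_mult_distrib_mat_vec[of _ d d]) (use AGA v in \<open>auto simp: pred_V_def\<close>)
  moreover have "1\<^sub>m d + pred_V \<gamma> \<alpha> X Xt S \<in> carrier_mat d d"
    using AGA by (auto simp: pred_V_def)
  ultimately have "pred_cov S *\<^sub>v v = \<sigma>\<^sup>2 \<cdot>\<^sub>v (v + (1 / (\<alpha> + \<gamma>)) \<cdot>\<^sub>v (?A *\<^sub>v u))"
    using v by (simp add: smult_mult_mat_vec[of _ d d])
  also have "\<dots> = (1 / (1 / \<sigma>\<^sup>2)) \<cdot>\<^sub>v v + (\<sigma>\<^sup>2 / (\<alpha> + \<gamma>)) \<cdot>\<^sub>v (?A *\<^sub>v u)"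
    using v A by (intro eq_vecI) (auto simp: algebra_simps)
  also have "(\<sigma>\<^sup>2 / (\<alpha> + \<gamma>)) \<cdot>\<^sub>v (?A *\<^sub>v u) = ?A *\<^sub>v ((\<sigma>\<^sup>2 / (\<alpha> + \<gamma>)) \<cdot>\<^sub>v u)"
    by (rule mult_mat_vec[OF A u, symmetric])
  also have "(\<sigma>\<^sup>2 / (\<alpha> + \<gamma>)) \<cdot>\<^sub>v u = mat_inv (post_prec S) *\<^sub>v (transpose_mat ?A *\<^sub>v v)"
    unfolding inv u_def by (rule smult_mult_mat_vec[symmetric]) (use A Gi v in auto)
  finally show "pred_cov S *\<^sub>v v = (1 / (1 / \<sigma>\<^sup>2)) \<cdot>\<^sub>v v
    + ?A *\<^sub>v (mat_inv (post_prec S) *\<^sub>v (transpose_mat ?A *\<^sub>v v))" .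
qed

abbreviation "pred_component S \<equiv> mvn (pred_mean X Xt y S) (pred_cov S)"

lemma mvn_density_pred_component:
  "S \<in> configs X \<Longrightarrow> mvn_density (pred_mean X Xt y S) (pred_cov S) yt
    = gauss_density (pred_prec S) (pred_mean X Xt y S) yt"
  by (intro mvn_density_eq_gauss[OF pred_cov_carrier pos_defD(1)[OF pos_def_pred_prec]
      pred_cov_mult_prec pred_mean_carrier])

lemma prob_space_pred_component: "S \<in> configs X \<Longrightarrow> prob_space (pred_component S)"
  by (rule prob_space_mvn[OF pos_def_pred_prec pred_mean_carrier pred_cov_carrier pred_cov_mult_prec])

lemma mvn_density_pred_nonneg:
  assumes "S \<in> configs X"
  shows "0 \<le> mvn_density (pred_mean X Xt y S) (pred_cov S) yt"
  unfolding mvn_density_pred_component[OF assms]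
  using pos_def_gauss[OF pos_def_pred_prec[OF assms] zero_carrier_vec] by (intro gauss_density_nonneg) simp

text \<open>On each configuration the new mean is \<open>sub_cols Xt S\<close> applied to the
  coefficients in \<open>S\<close>, so \<open>nn_integral_marginal\<close> evaluates the integral.
  Nonnegativity of the integrand and finiteness of the resulting sum allow the return to the Bochner
  integral.\<close>

lemma pred_density_eq:
  assumes yt: "yt \<in> carrier_vec d"
  shows "pred_density a c \<gamma> \<alpha> \<sigma> X Xt y yt
    = (\<Sum>S\<in>configs X. post S * mvn_density (pred_mean X Xt y S) (pred_cov S) yt)"
proof -
  let ?h = "\<lambda>\<beta>. mvn_density (Xt *\<^sub>v \<beta>) (\<sigma>\<^sup>2 \<cdot>\<^sub>m 1\<^sub>m d) yt"
  have iso: "(\<sigma>\<^sup>2 \<cdot>\<^sub>m 1\<^sub>m d) * ((1 / \<sigma>\<^sup>2) \<cdot>\<^sub>m 1\<^sub>m d) = 1\<^sub>m d"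
    using \<sigma> by (intro isotropic_mult) simp
  have h_eq: "?h \<beta> = gauss_density ((1 / \<sigma>\<^sup>2) \<cdot>\<^sub>m 1\<^sub>m d) (Xt *\<^sub>v \<beta>) yt" if "\<beta> \<in> carrier_vec p" for \<beta>
    by (rule mvn_density_eq_gauss[OF _ _ iso]) (use Xt that in auto)
  have h_nonneg: "0 \<le> gauss_density ((1 / \<sigma>\<^sup>2) \<cdot>\<^sub>m 1\<^sub>m d) m yt" for m
    using \<sigma> by (intro gauss_density_nonneg) simp
  have mh: "?h \<in> borel_measurable (lborel_vec p)"
    by (rule measurable_mvn_density[OF _ _ iso]) (use Xt yt measurable_mult_mat_vec in auto)
  have E: "sets (emp_posterior a c \<gamma> \<alpha> \<sigma> X y) = sets (lborel_vec p)"
    using X by (simp add: emp_posterior_def)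
  have component: "(\<integral>\<^sup>+b. ennreal (gauss_density (post_prec S) (lse X y S) b) * ennreal (?h (embed_config p S b)) \<partial>lborel_vec (card S))
      = ennreal (mvn_density (pred_mean X Xt y S) (pred_cov S) yt)" if S: "S \<in> configs X" for S
  proof -
    interpret linear_gaussian d "card S" "sub_cols Xt S" "post_prec S" "1 / \<sigma>\<^sup>2"
      by (rule linear_gaussian_config[OF S])
    have "ennreal (gauss_density (post_prec S) (lse X y S) b) * ennreal (?h (embed_config p S b))
      = ennreal (gauss_density ((1 / \<sigma>\<^sup>2) \<cdot>\<^sub>m 1\<^sub>m d) (sub_cols Xt S *\<^sub>v b) yt * gauss_density (post_prec S) (lse X y S) b)"
      if "b \<in> carrier_vec (card S)" for b
      unfolding h_eq[OF embed_config_carrier] unfolding mult_embed_config[OF Xt config_subset[OF S] that]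
      using h_nonneg by (simp add: ennreal_mult' mult.commute)
    then show ?thesis
      unfolding mvn_density_pred_component[OF S] unfolding pred_mean_def pred_prec_def
      using nn_integral_marginal[OF lse_carrier[OF S] yt] by (simp cong: nn_integral_cong_simp)
  qed
  have "pred_density a c \<gamma> \<alpha> \<sigma> X Xt y yt
      = enn2real (\<integral>\<^sup>+\<beta>. ennreal (?h \<beta>) \<partial>emp_posterior a c \<gamma> \<alpha> \<sigma> X y)"
  proof -
    have "?h \<in> borel_measurable (emp_posterior a c \<gamma> \<alpha> \<sigma> X y)"
      using mh unfolding measurable_cong_sets[OF E refl] .
    moreover have "AE \<beta> in emp_posterior a c \<gamma> \<alpha> \<sigma> X y. 0 \<le> ?h \<beta>"
      using sets_eq_imp_space_eq[OF E] h_eq h_nonneg by (intro AE_I2) simp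
    moreover have "dim_row Xt = d" using Xt by simp
    ultimately show ?thesis
      unfolding pred_density_def by (simp add: integral_eq_nn_integral)
  qed
  also have "(\<integral>\<^sup>+\<beta>. ennreal (?h \<beta>) \<partial>emp_posterior a c \<gamma> \<alpha> \<sigma> X y)
      = (\<Sum>S\<in>configs X. ennreal (post S) * ennreal (mvn_density (pred_mean X Xt y S) (pred_cov S) yt))"
    using mh by (simp add: nn_integral_posterior component)
  also have "\<dots> = ennreal (\<Sum>S\<in>configs X. post S * mvn_density (pred_mean X Xt y S) (pred_cov S) yt)"
    using post_nonneg mvn_density_pred_nonneg by (simp add: ennreal_mult'[symmetric] sum_ennreal)
  finally show ?thesis
    using post_nonneg mvn_density_pred_nonneg by (simp add: sum_nonneg)
qed

lemma measure_pred_dist: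
  assumes A: "A \<in> sets (lborel_vec d)"
  shows "measure (pred_dist a c \<gamma> \<alpha> \<sigma> X Xt y) A
    = (\<Sum>S\<in>configs X. post S * measure (pred_component S) A)"
proof -
  let ?f = "\<lambda>S yt. mvn_density (pred_mean X Xt y S) (pred_cov S) yt"
  have mf: "?f S \<in> borel_measurable (lborel_vec d)" if "S \<in> configs X" for S
    by (rule measurable_mvn_density[OF pred_cov_carrier pos_defD(1)[OF pos_def_pred_prec] pred_cov_mult_prec])
       (use that pred_mean_carrier in auto)
  have eq: "ennreal (pred_density a c \<gamma> \<alpha> \<sigma> X Xt y yt) = (\<Sum>S\<in>configs X. ennreal (post S) * ennreal (?f S yt))"
    if "yt \<in> carrier_vec d" for yt
    unfolding pred_density_eq[OF that]
    using post_nonneg mvn_density_pred_nonneg by (simp add: ennreal_mult'[symmetric] sum_ennreal)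
  \<comment> \<open>The mixture formula for the density is known on \<open>carrier_vec d\<close>,
    which is the whole space of the base measure.\<close>
  have "pred_dist a c \<gamma> \<alpha> \<sigma> X Xt y
      = density (lborel_vec d) (\<lambda>yt. \<Sum>S\<in>configs X. ennreal (post S) * ennreal (?f S yt))"
    unfolding pred_dist_def using Xt eq by (auto simp: density_def cong: nn_integral_cong_simp)
  then have "emeasure (pred_dist a c \<gamma> \<alpha> \<sigma> X Xt y) A
      = (\<integral>\<^sup>+yt. (\<Sum>S\<in>configs X. ennreal (post S) * ennreal (?f S yt)) * indicator A yt \<partial>lborel_vec d)"
    using mf A by (simp add: emeasure_density)
  also have "\<dots> = (\<integral>\<^sup>+yt. (\<Sum>S\<in>configs X. ennreal (post S) * (ennreal (?f S yt) * indicator A yt)) \<partial>lborel_vec d)"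
    by (simp add: sum_distrib_right mult.assoc)
  also have "\<dots> = (\<Sum>S\<in>configs X. ennreal (post S) * (\<integral>\<^sup>+yt. ennreal (?f S yt) * indicator A yt \<partial>lborel_vec d))"
    using mf A by (simp add: nn_integral_sum nn_integral_cmult)
  also have "\<dots> = (\<Sum>S\<in>configs X. ennreal (post S) * emeasure (pred_component S) A)"
  proof (rule sum.cong)
    fix S assume S: "S \<in> configs X"
    show "ennreal (post S) * (\<integral>\<^sup>+yt. ennreal (?f S yt) * indicator A yt \<partial>lborel_vec d)
      = ennreal (post S) * emeasure (pred_component S) A"
      unfolding mvn_def using pred_mean_carrier[OF S] mf[OF S] A by (simp add: emeasure_density)
  qed simp
  also have "\<dots> = ennreal (\<Sum>S\<in>configs X. post S * measure (pred_component S) A)"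
  proof -
    have "emeasure (pred_component S) A = ennreal (measure (pred_component S) A)" if "S \<in> configs X" for S
    proof -
      interpret prob_space "pred_component S" by (rule prob_space_pred_component[OF that])
      show ?thesis by (rule emeasure_eq_measure)
    qed
    then show ?thesis
      using post_nonneg by (simp add: ennreal_mult'[symmetric] sum_ennreal)
  qed
  finally show ?thesis
    using post_nonneg by (simp add: measure_def sum_nonneg)
qed

(* The two laws differ only through the mass that the mixture gives to the other configurations. *)
lemma tv_dist_pred_component:
  assumes S0: "S0 \<in> configs X"
  shows "tv_dist (pred_dist a c \<gamma> \<alpha> \<sigma> X Xt y) (pred_component S0) \<le> 1 - post S0"
    and "0 \<le> tv_dist (pred_dist a c \<gamma> \<alpha> \<sigma> X Xt y) (pred_component S0)"
proof -
  let ?P = "pred_dist a c \<gamma> \<alpha> \<sigma> X Xt y"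
  have sets: "sets ?P = sets (lborel_vec d)" using Xt by (simp add: pred_dist_def)
  have bound: "\<bar>measure ?P A - measure (pred_component S0) A\<bar> \<le> 1 - post S0" if A: "A \<in> sets ?P" for A
  proof -
    let ?\<nu> = "\<lambda>S. measure (pred_component S) A"
    have \<nu>: "0 \<le> ?\<nu> S" "?\<nu> S \<le> 1" if "S \<in> configs X" for S
      using prob_space.prob_le_1[OF prob_space_pred_component[OF that]] by auto
    \<comment> \<open>As the weights sum to 1, the reference probability can be spread over the same
      weights; the term of \<open>S0\<close> then vanishes.\<close>
    have "measure ?P A - ?\<nu> S0 = (\<Sum>S\<in>configs X. post S * ?\<nu> S) - (\<Sum>S\<in>configs X. post S) * ?\<nu> S0"
      using A unfolding sets by (simp add: measure_pred_dist sum_post)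
    also have "\<dots> = (\<Sum>S\<in>configs X. post S * (?\<nu> S - ?\<nu> S0))"
      by (simp add: sum_distrib_right sum_subtractf algebra_simps)
    also have "\<dots> = (\<Sum>S\<in>configs X - {S0}. post S * (?\<nu> S - ?\<nu> S0))"
      by (subst sum.remove[OF finite_configs S0]) simp
    also have "\<bar>\<dots>\<bar> \<le> (\<Sum>S\<in>configs X - {S0}. post S)"
    proof (rule order_trans[OF sum_abs sum_mono])
      fix S assume "S \<in> configs X - {S0}"
      then have "S \<in> configs X" by simp
      from \<nu>[OF this] \<nu>[OF S0] have "\<bar>?\<nu> S - ?\<nu> S0\<bar> \<le> 1"
        unfolding abs_le_iff by linarith
      then show "\<bar>post S * (?\<nu> S - ?\<nu> S0)\<bar> \<le> post S"
        using post_nonneg[of S] by (simp add: abs_mult mult_left_le)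
    qed
    also have "\<dots> = 1 - post S0"
      using sum.remove[OF finite_configs S0, of post] sum_post by simp
    finally show ?thesis .
  qed
  show "tv_dist ?P (pred_component S0) \<le> 1 - post S0"
    unfolding tv_dist_def by (rule cSUP_least[OF _ bound]) auto
  \<comment> \<open>The empty set is a witness for nonnegativity; a real supremum dominates its
    members only over a bounded family, and \<open>bound\<close> gives the boundedness.\<close>
  have "\<bar>measure ?P {} - measure (pred_component S0) {}\<bar> \<le> tv_dist ?P (pred_component S0)"
    unfolding tv_dist_def by (rule cSUP_upper) (auto intro!: bdd_aboveI2[where M = "1 - post S0"] bound)
  then show "0 \<le> tv_dist ?P (pred_component S0)" by simp
qed

end

section \<open>Expectations and the passage to the limit\<close>

theorem corollary3:
  fixes d :: nat
    and p :: "nat \<Rightarrow> nat"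
    and X Xt :: "nat \<Rightarrow> real mat"
    and \<beta> :: "nat \<Rightarrow> real Matrix.vec"
    and a c \<gamma> \<alpha> \<sigma> :: real
  assumes "d \<ge> 1"
    and "a > 0" and "c > 0" and "\<gamma> > 0" and "0 < \<alpha>" and "\<alpha> < 1" and "\<sigma> > 0"
    and "\<And>n. n \<ge> 1 \<Longrightarrow> p n \<ge> n"
    and "\<And>n. n \<ge> 1 \<Longrightarrow> X n \<in> carrier_mat n (p n)"
    and "\<And>n. n \<ge> 1 \<Longrightarrow> mat_rank (X n) = n"
    and "\<And>n S. n \<ge> 1 \<Longrightarrow> S \<in> configs (X n) \<Longrightarrow> invertible_mat (gram (X n) S)"
    and "\<And>n. n \<ge> 1 \<Longrightarrow> Xt n \<in> carrier_mat d (p n)"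
    and "\<And>n. n \<ge> 1 \<Longrightarrow> \<beta> n \<in> carrier_vec (p n)"
    and "(\<lambda>n. real (card (vec_support (\<beta> n)))
              * ln (real (p n) / real (card (vec_support (\<beta> n))))) \<in> o(\<lambda>n. real n)"
    and "(\<lambda>n. \<integral>y. config_posterior a c \<gamma> \<alpha> \<sigma> (X n) y (vec_support (\<beta> n))
                 \<partial>mvn (X n *\<^sub>v \<beta> n) (\<sigma>\<^sup>2 \<cdot>\<^sub>m 1\<^sub>m n)) \<longlonglongrightarrow> 1"
  shows "(\<lambda>n. \<integral>y. tv_dist (pred_dist a c \<gamma> \<alpha> \<sigma> (X n) (Xt n) y)
                   (mvn (pred_mean (X n) (Xt n) y (vec_support (\<beta> n)))
                        (\<sigma>\<^sup>2 \<cdot>\<^sub>m (1\<^sub>m d + pred_V \<gamma> \<alpha> (X n) (Xt n) (vec_support (\<beta> n)))))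
                 \<partial>mvn (X n *\<^sub>v \<beta> n) (\<sigma>\<^sup>2 \<cdot>\<^sub>m 1\<^sub>m n)) \<longlonglongrightarrow> 0"
proof -
  let ?S = "\<lambda>n. vec_support (\<beta> n)"
  let ?D = "\<lambda>n. mvn (X n *\<^sub>v \<beta> n) (\<sigma>\<^sup>2 \<cdot>\<^sub>m 1\<^sub>m n)"
  let ?\<pi> = "\<lambda>n y. config_posterior a c \<gamma> \<alpha> \<sigma> (X n) y (?S n)"
  let ?tv = "\<lambda>n y. tv_dist (pred_dist a c \<gamma> \<alpha> \<sigma> (X n) (Xt n) y)
      (mvn (pred_mean (X n) (Xt n) y (?S n)) (\<sigma>\<^sup>2 \<cdot>\<^sub>m (1\<^sub>m d + pred_V \<gamma> \<alpha> (X n) (Xt n) (?S n))))"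
  \<comment> \<open>The positivity assumption is used twice. A configuration outside
    \<open>configs\<close> has posterior mass 0 for every \<open>y\<close>, so the true one must lie
    inside; and a non-integrable function has Bochner integral 0, so the posterior mass is
    integrable.\<close>
  have bounds: "0 \<le> (\<integral>y. ?tv n y \<partial>?D n) \<and> (\<integral>y. ?tv n y \<partial>?D n) \<le> 1 - (\<integral>y. ?\<pi> n y \<partial>?D n)"
    if n: "n \<ge> 1" and pos: "(\<integral>y. ?\<pi> n y \<partial>?D n) > 0" for n
  proof -
    have Xb: "X n *\<^sub>v \<beta> n \<in> carrier_vec n" using assms(9,13)[OF n] by auto
    have space: "space (?D n) = carrier_vec n" using Xb by simp
    interpret prob_space "?D n"
      using assms(7) Xb
      by (intro prob_space_mvn[of n "(1 / \<sigma>\<^sup>2) \<cdot>\<^sub>m 1\<^sub>m n"] pos_def_smult pos_def_one isotropic_mult) auto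
    have S: "?S n \<in> configs (X n)"
    proof (rule ccontr)
      assume "?S n \<notin> configs (X n)"
      then have "?\<pi> n y = 0" for y
        by (simp add: config_posterior_def config_weight_def config_prior_def Let_def)
      with pos show False by simp
    qed
    have int: "integrable (?D n) (?\<pi> n)"
      using pos not_integrable_integral_eq by fastforce
    have tv: "0 \<le> ?tv n y" "?tv n y \<le> 1 - ?\<pi> n y" if "y \<in> space (?D n)" for y
    proof -
      interpret empirical_bayes n "p n" d "X n" "Xt n" y a c \<gamma> \<alpha> \<sigma>
        using assms n that unfolding space by unfold_locales (auto intro: order_trans)
      show "0 \<le> ?tv n y" "?tv n y \<le> 1 - ?\<pi> n y" using tv_dist_pred_component[OF S] by auto
    qed
    (* No measurability of the total variation distance in y is needed: if it failed,
       the integral on the left would be 0. *)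
    have "(\<integral>y. ?tv n y \<partial>?D n) \<le> (\<integral>y. 1 - ?\<pi> n y \<partial>?D n)"
      by (rule integral_mono'[OF _ tv(2) order_trans[OF tv]]) (use int in simp_all)
    also have "\<dots> = 1 - (\<integral>y. ?\<pi> n y \<partial>?D n)"
      using int by (simp add: prob_space)
    finally show ?thesis
      using tv(1) by (auto intro!: integral_nonneg_AE AE_I2)
  qed
  have ev: "eventually (\<lambda>n. n \<ge> 1 \<and> (\<integral>y. ?\<pi> n y \<partial>?D n) > 0) sequentially"
    by (rule eventually_conj[OF eventually_ge_at_top[of 1]])
       (use order_tendstoD(1)[OF assms(15), of 0] in simp)
  show ?thesis
  proof (rule tendsto_sandwich)
    show "eventually (\<lambda>n. 0 \<le> (\<integral>y. ?tv n y \<partial>?D n)) sequentially"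
      using ev by eventually_elim (use bounds in auto)
    show "eventually (\<lambda>n. (\<integral>y. ?tv n y \<partial>?D n) \<le> 1 - (\<integral>y. ?\<pi> n y \<partial>?D n)) sequentially"
      using ev by eventually_elim (use bounds in auto)
    show "(\<lambda>n. 1 - (\<integral>y. ?\<pi> n y \<partial>?D n)) \<longlonglongrightarrow> 0"
      using tendsto_diff[OF tendsto_const[of 1] assms(15)] by simp
  qed simp
qed

end
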